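(* Let $\mathbf{K}$ be an abstract elementary class such that: (1) $\mathbf{K}$ is superstable in $\aleph_0$; (2) $\mathbf{K}$ has symmetry in $\aleph_0$; (3) $\mathbf{K}$ has transitivity in $\aleph_0$; (4) $\mathbf{K}$ is categorical in $\aleph_0$; (5) $\mathbf{K}$ is saturative in $\aleph_0$. Then there exists a type-full good $\aleph_0$-frame with underlying class $\mathbf{K}_{\aleph_0}$.
   Context: Let $\mathbf{K}$ be an AEC, $\mu\ge\mathrm{LS}(\mathbf{K})$. For $M_0\le M_1$ in $\mathbf{K}_\mu$: $M_1$ is universal over $M_0$ if every $N\in\mathbf{K}_\mu$ with $M_0\le N$ embeds into $M_1$ over $M_0$; $M_1$ is limit over $M_0$ if there are a limit $\delta<\mu^+$ and an increasing continuous $\langle N_i:i\le\delta\rangle$ in $\mathbf{K}_\mu$ with $N_0=M_0$, $N_\delta=M_1$, $N_{i+1}$ universal over $N_i$. For $M\le N$ in $\mathbf{K}_\mu$, $p\in\mathrm{gS}(N)$ $\mu$-splits over $M$ if there are $N_1,N_2\in\mathbf{K}_\mu$ with $M\le N_\ell\le N$ and an isomorphism $f:N_1\cong N_2$ fixing $M$ with $f(p\upharpoonright N_1)\ne p\upharpoonright N_2$. $\mathbf{K}$ is $\mu$-superstable if $\mathbf{K}_\mu$ is nonempty with joint embedding, amalgamation, no maximal models, $\mathbf{K}$ is Galois-stable in $\mu$, and for every limit $\delta<\mu^+$, every increasing $\langle M_i:i<\delta\rangle$ in $\mathbf{K}_\mu$ with $M_{i+1}$ universal over $M_i$, and every $p\in\mathrm{gS}(\bigcup_{i<\delta}M_i)$,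 there is $i<\delta$ such that $p$ does not $\mu$-split over $M_i$. $\mathbf{K}$ has $\mu$-symmetry if whenever $M,M_0,N\in\mathbf{K}_\mu$ and elements $a,b$ satisfy: $M$ universal over $M_0$ and $M_0$ limit over $N$; $a\in|M|\setminus|M_0|$; $\mathrm{gtp}(a/M_0)$ nonalgebraic and not $\mu$-splitting over $N$; $\mathrm{gtp}(b/M)$ nonalgebraic and not $\mu$-splitting over $M_0$ — then there is $M^b$ limit over $M_0$, containing $b$, such that $\mathrm{gtp}(a/M^b)$ does not $\mu$-split over $N$. $\mathbf{K}$ has $\mu$-transitivity if whenever $M_0,M_1,M_2\in\mathbf{K}_\mu$, $M_1$ limit over $M_0$, $M_2$ limit over $M_1$, $p\in\mathrm{gS}(M_2)$ does not $\mu$-split over $M_1$ and $p\upharpoonright M_1$ does not $\mu$-split over $M_0$, then $p$ does not $\mu$-split over $M_0$. $\mathbf{K}$ is saturative in $\mu$ if for $M_0\le M_1\le M_2$ in $\mathbf{K}_\mu$ with $M_1$ limit over $M_0$, $M_2$ is limit over $M_0$. Good $\lambda$-frame: $\mathbf{K}_\lambda\ne\emptyset$ with amalgamation, joint embedding, no maximal models, $\mathbf{K}$ stable in $\lambda$, basic types $S^{bs}(M)$ forming a dense set of nonalgebraic Galois types over each $M\in\mathbf{K}_\lambda$, and a nonforking relation on basic types satisfying invariance, monotonicity, extension, uniqueness, continuity, local character and symmetry (Shelah, Classification Theory for AECs, II.2.1, without the superlimit axiom). Type-full: all nonalgebraic types are basic. *)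

theory Defs
  imports Main "HOL-Library.Countable_Set" "HOL-Library.Equipollence"
begin

record ('a,'r) struc =
  s_univ :: "'a set"
  s_rel :: "'r \<Rightarrow> 'a list set"

definition wf_struc :: "('r \<Rightarrow> nat) \<Rightarrow> ('a,'r) struc \<Rightarrow> bool" where
  "wf_struc ar M \<longleftrightarrow> (\<forall>R. \<forall>xs\<in>s_rel M R. length xs = ar R \<and> set xs \<subseteq> s_univ M)"

definition substruc :: "('a,'r) struc \<Rightarrow> ('a,'r) struc \<Rightarrow> bool" where
  "substruc M N \<longleftrightarrow> s_univ M \<subseteq> s_univ N \<and>
     (\<forall>R. s_rel M R = {xs\<in>s_rel N R. set xs \<subseteq> s_univ M})"

definition img :: "('a \<Rightarrow> 'a) \<Rightarrow> ('a,'r) struc \<Rightarrow> ('a,'r) struc" where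
  "img f M = \<lparr>s_univ = f ` s_univ M, s_rel = (\<lambda>R. map f ` s_rel M R)\<rparr>"

definition is_iso :: "('a \<Rightarrow> 'a) \<Rightarrow> ('a,'r) struc \<Rightarrow> ('a,'r) struc \<Rightarrow> bool" where
  "is_iso f M N \<longleftrightarrow> bij_betw f (s_univ M) (s_univ N) \<and> (\<forall>R. s_rel N R = map f ` s_rel M R)"

definition UnionS :: "('a,'r) struc set \<Rightarrow> ('a,'r) struc" where
  "UnionS C = \<lparr>s_univ = (\<Union>M\<in>C. s_univ M), s_rel = (\<lambda>R. \<Union>M\<in>C. s_rel M R)\<rparr>"

definition aec :: "('r \<Rightarrow> nat) \<Rightarrow> ('a,'r) struc set \<Rightarrow> (('a,'r) struc \<Rightarrow> ('a,'r) struc \<Rightarrow> bool) \<Rightarrow> bool" where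
  "aec ar K le \<longleftrightarrow>
     (\<forall>M\<in>K. wf_struc ar M)
   \<and> (\<forall>M N f. M \<in> K \<and> wf_struc ar N \<and> is_iso f M N \<longrightarrow> N \<in> K)
   \<and> (\<forall>M N. le M N \<longrightarrow> M \<in> K \<and> N \<in> K)
   \<and> (\<forall>M\<in>K. le M M)
   \<and> (\<forall>M N P. le M N \<and> le N P \<longrightarrow> le M P)
   \<and> (\<forall>M N. le M N \<longrightarrow> substruc M N)
   \<and> (\<forall>M N N' f. le M N \<and> N' \<in> K \<and> is_iso f N N' \<longrightarrow> le (img f M) N')
   \<and> (\<forall>M0 M1 M2. M0 \<in> K \<and> M1 \<in> K \<and> M2 \<in> K \<and> substruc M0 M1 \<and> le M0 M2 \<and> le M1 M2
        \<longrightarrow> le M0 M1)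
   \<and> (\<forall>C. C \<noteq> {} \<and> C \<subseteq> K \<and> (\<forall>M\<in>C. \<forall>N\<in>C. le M N \<or> le N M) \<longrightarrow>
        UnionS C \<in> K \<and> (\<forall>M\<in>C. le M (UnionS C)) \<and>
        (\<forall>N. (\<forall>M\<in>C. le M N) \<longrightarrow> le (UnionS C) N))"

definition ls_le_aleph0 :: "('r \<Rightarrow> nat) \<Rightarrow> ('a,'r) struc set \<Rightarrow> (('a,'r) struc \<Rightarrow> ('a,'r) struc \<Rightarrow> bool) \<Rightarrow> bool" where
  "ls_le_aleph0 ar K le \<longleftrightarrow> countable (UNIV :: 'r set) \<and>
     (\<forall>N\<in>K. \<forall>A. A \<subseteq> s_univ N \<longrightarrow>
        (\<exists>M. le M N \<and> A \<subseteq> s_univ M \<and> s_univ M \<lesssim> A <+> (UNIV :: nat set)))"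

definition Kc :: "('a,'r) struc set \<Rightarrow> ('a,'r) struc set" where
  "Kc K = {M\<in>K. infinite (s_univ M) \<and> countable (s_univ M)}"

definition kemb :: "('a,'r) struc set \<Rightarrow> (('a,'r) struc \<Rightarrow> ('a,'r) struc \<Rightarrow> bool) \<Rightarrow>
    ('a \<Rightarrow> 'a) \<Rightarrow> ('a,'r) struc \<Rightarrow> ('a,'r) struc \<Rightarrow> bool" where
  "kemb K le f M N \<longleftrightarrow> M \<in> K \<and> N \<in> K \<and> inj_on f (s_univ M) \<and> le (img f M) N"

definition universal_over where
  "universal_over K le M0 M1 \<longleftrightarrow> M0 \<in> Kc K \<and> M1 \<in> Kc K \<and> le M0 M1 \<and>
     (\<forall>N\<in>Kc K. le M0 N \<longrightarrow> (\<exists>f. kemb K le f N M1 \<and> (\<forall>x\<in>s_univ M0. f x = x)))"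

text \<open>Countable limit ordinals delta < aleph_1 are represented by well-orders on subsets of nat
  whose field is nonempty and has no largest element; a sequence indexed by i < delta is a function
  on the field of the well-order.\<close>

definition wo_limit :: "nat rel \<Rightarrow> bool" where
  "wo_limit r \<longleftrightarrow> Well_order r \<and> Field r \<noteq> {} \<and> (\<forall>i\<in>Field r. \<exists>j\<in>Field r. (i,j) \<in> r \<and> i \<noteq> j)"

definition wo_min :: "nat rel \<Rightarrow> nat \<Rightarrow> bool" where
  "wo_min r i \<longleftrightarrow> i \<in> Field r \<and> (\<forall>j\<in>Field r. (i,j) \<in> r)"

definition wo_succ :: "nat rel \<Rightarrow> nat \<Rightarrow> nat \<Rightarrow> bool" where
  "wo_succ r i j \<longleftrightarrow> (i,j) \<in> r \<and> i \<noteq> j \<and> (\<forall>k. (i,k) \<in> r \<and> (k,j) \<in> r \<longrightarrow> k = i \<or> k = j)"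

definition wo_below :: "nat rel \<Rightarrow> nat \<Rightarrow> nat set" where
  "wo_below r i = {j. (j,i) \<in> r \<and> j \<noteq> i}"

definition wo_limpt :: "nat rel \<Rightarrow> nat \<Rightarrow> bool" where
  "wo_limpt r i \<longleftrightarrow> i \<in> Field r \<and> \<not> wo_min r i \<and> (\<nexists>j. wo_succ r j i)"

definition incr_chain where
  "incr_chain K le r N \<longleftrightarrow> (\<forall>i\<in>Field r. N i \<in> Kc K) \<and> (\<forall>i j. (i,j) \<in> r \<longrightarrow> le (N i) (N j))"

definition cont_chain :: "nat rel \<Rightarrow> (nat \<Rightarrow> ('a,'r) struc) \<Rightarrow> bool" where
  "cont_chain r N \<longleftrightarrow> (\<forall>i. wo_limpt r i \<longrightarrow> N i = UnionS (N ` wo_below r i))"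

definition limit_over where
  "limit_over K le M0 M1 \<longleftrightarrow> M0 \<in> Kc K \<and> M1 \<in> Kc K \<and>
     (\<exists>r N i0. wo_limit r \<and> wo_min r i0 \<and> N i0 = M0 \<and> incr_chain K le r N \<and> cont_chain r N \<and>
        (\<forall>i j. wo_succ r i j \<longrightarrow> universal_over K le (N i) (N j)) \<and>
        M1 = UnionS (N ` Field r))"

text \<open>A triple (a,N) over M is valid if M \<le> N and a \<in> |N|; Galois types over M are the
  classes of the transitive closure of atomic equivalence.  A type is represented as the set of
  all its realizations (a,N).\<close>

definition valid_tr where
  "valid_tr K le M t \<longleftrightarrow> le M (snd t) \<and> fst t \<in> s_univ (snd t)"

definition E_at where
  "E_at K le M t1 t2 \<longleftrightarrow> (\<exists>N f1 f2. kemb K le f1 (snd t1) N \<and> kemb K le f2 (snd t2) N \<and>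
      (\<forall>x\<in>s_univ M. f1 x = f2 x) \<and> f1 (fst t1) = f2 (fst t2))"

definition gtp_eq where
  "gtp_eq K le M t1 t2 \<longleftrightarrow> valid_tr K le M t1 \<and>
     (\<lambda>x y. valid_tr K le M x \<and> valid_tr K le M y \<and> E_at K le M x y)\<^sup>*\<^sup>* t1 t2"

definition gtp where
  "gtp K le M a N = {t. gtp_eq K le M (a,N) t}"

definition gS where
  "gS K le M = {gtp K le M a N | a N. le M N \<and> a \<in> s_univ N}"

definition gS_na where
  "gS_na K le M = {p \<in> gS K le M. \<forall>t\<in>p. fst t \<notin> s_univ M}"

definition restr where
  "restr K le M0 p = {t. \<exists>t0\<in>p. gtp_eq K le M0 t0 t}"

definition tp_img where
  "tp_img K le f N1 N2 q = {t. \<exists>t0\<in>q. \<exists>g N'. kemb K le g (snd t0) N' \<and>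
      (\<forall>x\<in>s_univ N1. g x = f x) \<and> gtp_eq K le N2 (g (fst t0), N') t}"

definition splits where
  "splits K le M N p \<longleftrightarrow> (\<exists>N1 N2 f. N1 \<in> Kc K \<and> N2 \<in> Kc K \<and> le M N1 \<and> le N1 N \<and> le M N2 \<and>
      le N2 N \<and> is_iso f N1 N2 \<and> (\<forall>x\<in>s_univ M. f x = x) \<and>
      tp_img K le f N1 N2 (restr K le N1 p) \<noteq> restr K le N2 p)"

definition jep_c where
  "jep_c K le \<longleftrightarrow> (\<forall>M1\<in>Kc K. \<forall>M2\<in>Kc K. \<exists>N\<in>Kc K. \<exists>f1 f2. kemb K le f1 M1 N \<and> kemb K le f2 M2 N)"

definition ap_c where
  "ap_c K le \<longleftrightarrow> (\<forall>M0\<in>Kc K. \<forall>M1\<in>Kc K. \<forall>M2\<in>Kc K. le M0 M1 \<and> le M0 M2 \<longrightarrow>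
     (\<exists>N\<in>Kc K. \<exists>f1 f2. kemb K le f1 M1 N \<and> kemb K le f2 M2 N \<and> (\<forall>x\<in>s_univ M0. f1 x = f2 x)))"

definition nmm_c where
  "nmm_c K le \<longleftrightarrow> (\<forall>M\<in>Kc K. \<exists>N\<in>Kc K. le M N \<and> M \<noteq> N)"

definition stable_c where
  "stable_c K le \<longleftrightarrow> (\<forall>M\<in>Kc K. countable (gS K le M))"

definition superstable_c where
  "superstable_c K le \<longleftrightarrow> Kc K \<noteq> {} \<and> jep_c K le \<and> ap_c K le \<and> nmm_c K le \<and> stable_c K le \<and>
     (\<forall>r N. wo_limit r \<and> incr_chain K le r N \<and>
        (\<forall>i j. wo_succ r i j \<longrightarrow> universal_over K le (N i) (N j)) \<longrightarrow>
        (\<forall>p\<in>gS K le (UnionS (N ` Field r)).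
           \<exists>i\<in>Field r. \<not> splits K le (N i) (UnionS (N ` Field r)) p))"

definition symmetry_c where
  "symmetry_c K le \<longleftrightarrow>
    (\<forall>M M0 N a b N1. M \<in> Kc K \<and> M0 \<in> Kc K \<and> N \<in> Kc K \<and>
       universal_over K le M0 M \<and> limit_over K le N M0 \<and>
       a \<in> s_univ M - s_univ M0 \<and>
       gtp K le M0 a M \<in> gS_na K le M0 \<and> \<not> splits K le N M0 (gtp K le M0 a M) \<and>
       le M N1 \<and> b \<in> s_univ N1 \<and>
       gtp K le M b N1 \<in> gS_na K le M \<and> \<not> splits K le M0 M (gtp K le M b N1)
     \<longrightarrow> (\<exists>Mb N2. limit_over K le M0 Mb \<and> b \<in> s_univ Mb \<and> le N1 N2 \<and> le Mb N2 \<and>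
            \<not> splits K le N Mb (gtp K le Mb a N2)))"

definition transitivity_c where
  "transitivity_c K le \<longleftrightarrow>
    (\<forall>M0 M1 M2 p. M0 \<in> Kc K \<and> M1 \<in> Kc K \<and> M2 \<in> Kc K \<and>
       limit_over K le M0 M1 \<and> limit_over K le M1 M2 \<and> p \<in> gS K le M2 \<and>
       \<not> splits K le M1 M2 p \<and> \<not> splits K le M0 M1 (restr K le M1 p)
     \<longrightarrow> \<not> splits K le M0 M2 p)"

definition saturative_c where
  "saturative_c K le \<longleftrightarrow>
    (\<forall>M0 M1 M2. M0 \<in> Kc K \<and> M1 \<in> Kc K \<and> M2 \<in> Kc K \<and> le M0 M1 \<and> le M1 M2 \<and>
       limit_over K le M0 M1 \<longrightarrow> limit_over K le M0 M2)"

definition categorical_c where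
  "categorical_c K le \<longleftrightarrow> Kc K \<noteq> {} \<and> (\<forall>M\<in>Kc K. \<forall>N\<in>Kc K. \<exists>f. is_iso f M N)"

section \<open>Good aleph_0-frames (Shelah, Classification Theory for AECs, II.2.1, without superlimit)\<close>

text \<open>Sbs M is the set of basic types over M; nf M0 M1 a M3 means
  gtp(a/M1;M3) does not fork over M0.\<close>

definition good_frame_c ::
  "('r \<Rightarrow> nat) \<Rightarrow> ('a,'r) struc set \<Rightarrow> (('a,'r) struc \<Rightarrow> ('a,'r) struc \<Rightarrow> bool) \<Rightarrow>
   (('a,'r) struc \<Rightarrow> ('a \<times> ('a,'r) struc) set set) \<Rightarrow>
   (('a,'r) struc \<Rightarrow> ('a,'r) struc \<Rightarrow> 'a \<Rightarrow> ('a,'r) struc \<Rightarrow> bool) \<Rightarrow> bool" where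
  "good_frame_c ar K le Sbs nf \<longleftrightarrow>
   \<comment> \<open>(A)\<close>
     aec ar K le \<and> ls_le_aleph0 ar K le
   \<comment> \<open>(B)\<close>
   \<and> Kc K \<noteq> {} \<and> ap_c K le \<and> jep_c K le \<and> nmm_c K le
   \<comment> \<open>(C) stability\<close>
   \<and> stable_c K le
   \<comment> \<open>(D) basic types\<close>
   \<and> (\<forall>M\<in>Kc K. Sbs M \<subseteq> gS_na K le M)
   \<and> (\<forall>M M' f p. M \<in> Kc K \<and> M' \<in> Kc K \<and> is_iso f M M' \<and> p \<in> Sbs M \<longrightarrow>
        tp_img K le f M M' p \<in> Sbs M')
   \<and> (\<forall>M\<in>Kc K. \<forall>N\<in>Kc K. le M N \<and> M \<noteq> N \<longrightarrow>
        (\<exists>a\<in>s_univ N - s_univ M. gtp K le M a N \<in> Sbs M))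
   \<and> (\<forall>M\<in>Kc K. countable (Sbs M))
   \<comment> \<open>(E)(a) basic properties and invariance\<close>
   \<and> (\<forall>M0 M1 a M3. nf M0 M1 a M3 \<longrightarrow>
        M0 \<in> Kc K \<and> M1 \<in> Kc K \<and> M3 \<in> Kc K \<and> le M0 M1 \<and> le M1 M3 \<and> a \<in> s_univ M3 \<and>
        gtp K le M1 a M3 \<in> Sbs M1)
   \<and> (\<forall>M0 M1 a M3 M3' f. nf M0 M1 a M3 \<and> M3' \<in> Kc K \<and> is_iso f M3 M3' \<longrightarrow>
        nf (img f M0) (img f M1) (f a) M3')
   \<comment> \<open>(E)(b) monotonicity\<close>
   \<and> (\<forall>M0 M1 a M3 M0' M1'. nf M0 M1 a M3 \<and> M0' \<in> Kc K \<and> M1' \<in> Kc K \<and>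
        le M0 M0' \<and> le M0' M1' \<and> le M1' M1 \<longrightarrow> nf M0' M1' a M3)
   \<and> (\<forall>M0 M1 a M3 M3'. nf M0 M1 a M3 \<and> M3' \<in> Kc K \<and> le M3 M3' \<longrightarrow> nf M0 M1 a M3')
   \<and> (\<forall>M0 M1 a M3 M3'. nf M0 M1 a M3 \<and> M3' \<in> Kc K \<and> le M1 M3' \<and> le M3' M3 \<and>
        a \<in> s_univ M3' \<longrightarrow> nf M0 M1 a M3')
   \<comment> \<open>(E)(c) local character\<close>
   \<and> (\<forall>r N a M3. wo_limit r \<and> incr_chain K le r N \<and> cont_chain r N \<and>
        UnionS (N ` Field r) \<in> Kc K \<and> M3 \<in> Kc K \<and> le (UnionS (N ` Field r)) M3 \<and>
        a \<in> s_univ M3 \<and> gtp K le (UnionS (N ` Field r)) a M3 \<in> Sbs (UnionS (N ` Field r)) \<longrightarrow>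
        (\<exists>i\<in>Field r. nf (N i) (UnionS (N ` Field r)) a M3))
   \<comment> \<open>(E)(d) transitivity\<close>
   \<and> (\<forall>M0 M1 M2 a M3. le M0 M1 \<and> le M1 M2 \<and> nf M1 M2 a M3 \<and> nf M0 M1 a M3 \<longrightarrow>
        nf M0 M2 a M3)
   \<comment> \<open>(E)(e) uniqueness\<close>
   \<and> (\<forall>M0 M1 a N b N'. nf M0 M1 a N \<and> nf M0 M1 b N' \<and> gtp K le M0 a N = gtp K le M0 b N' \<longrightarrow>
        gtp K le M1 a N = gtp K le M1 b N')
   \<comment> \<open>(E)(f) symmetry\<close>
   \<and> (\<forall>M0 M1 M3 a1 a2. M0 \<in> Kc K \<and> M1 \<in> Kc K \<and> M3 \<in> Kc K \<and> le M0 M1 \<and> le M1 M3 \<and>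
        a1 \<in> s_univ M1 \<and> a2 \<in> s_univ M3 \<and> gtp K le M0 a1 M3 \<in> Sbs M0 \<and> nf M0 M1 a2 M3 \<longrightarrow>
        (\<exists>M2 M3'. M2 \<in> Kc K \<and> M3' \<in> Kc K \<and> a2 \<in> s_univ M2 \<and> le M0 M2 \<and> le M2 M3' \<and>
           le M3 M3' \<and> nf M0 M2 a1 M3'))
   \<comment> \<open>(E)(g) extension\<close>
   \<and> (\<forall>M N p. M \<in> Kc K \<and> N \<in> Kc K \<and> le M N \<and> p \<in> Sbs M \<longrightarrow>
        (\<exists>b N'. nf M N b N' \<and> restr K le M (gtp K le N b N') = p))
   \<comment> \<open>(E)(h) continuity\<close>
   \<and> (\<forall>r N i0 a M3. wo_limit r \<and> wo_min r i0 \<and> incr_chain K le r N \<and> cont_chain r N \<and>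
        UnionS (N ` Field r) \<in> Kc K \<and> M3 \<in> Kc K \<and> le (UnionS (N ` Field r)) M3 \<and>
        a \<in> s_univ M3 \<and> (\<forall>i\<in>Field r. nf (N i0) (N i) a M3) \<longrightarrow>
        nf (N i0) (UnionS (N ` Field r)) a M3)"

definition type_full_c where
  "type_full_c K le Sbs \<longleftrightarrow> (\<forall>M\<in>Kc K. Sbs M = gS_na K le M)"

end

theory Submission
  imports Defs
begin

text \<open>
  A nonalgebraic type over \<open>M1\<close> is declared not to fork over \<open>M0\<close> if it does not split over some \<open>N\<close>
  such that \<open>M0\<close> is a limit model over \<open>N\<close>. By categoricity every model is a limit model over something,
  and by saturativity it stays one over the same base when it is enlarged, so monotonicity is immediate.
  Nonsplitting types have unique nonsplitting extensions above a universal extension of the base;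
  transitivity lets one compare types whose witnesses \<open>N\<close> differ, which gives uniqueness and with it
  transitivity of nonforking. Local character holds along arbitrary chains \<open>Q n\<close>, because one can choose
  \<open>R n\<close> such that \<open>Q n\<close> is limit over \<open>R n\<close>, the chain \<open>R n\<close> has universal steps, and both chains have
  the same union; superstability applies to \<open>R n\<close>. Symmetry of the frame reduces to symmetry of the
  class after moving the second element over a universal extension of \<open>M1\<close>.
\<close>

text \<open>Weak uniqueness of nonsplitting compares types over \<open>N\<close> by folding
  \<open>N\<close> into \<open>M\<close> over the base, which needs \<open>M\<close> to be universal
  over the base. Nonsplitting over \<open>M0\<close> itself leaves no such gap below
  \<open>M0\<close>; this is why the witness of nonforking sits beneath \<open>M0\<close>, with
  \<open>M0\<close> limit over it. The price is that nonforking is existential in its witness, so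
  that two elements may come with unrelated ones. Local character meets another obstacle: the frame
  asks for it along arbitrary increasing chains, whereas superstability speaks of chains with
  universal steps. Two features of the setting shape the rest. Models consist of points of one fixed
  type, so renaming a model needs fresh points; countable models in an uncountable type always have
  them. Galois types are defined through extensions of any size, while amalgamation is available for
  countable models; the Lowenheim-Skolem property has to cut the witnesses down to countable
  ones.\<close>

lemma struc_eqI:
  fixes M N :: "('a,'r) struc"
  shows "s_univ M = s_univ N \<Longrightarrow> s_rel M = s_rel N \<Longrightarrow> M = N"
  by simp

lemma univ_img [simp]: "s_univ (img f M) = f ` s_univ M"
  by (simp add: img_def)

lemma univ_UnionS [simp]: "s_univ (UnionS C) = (\<Union>M\<in>C. s_univ M)"
  by (simp add: UnionS_def)

lemma img_img: "img g (img f M) = img (g \<circ> f) M"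
  by (simp add: img_def image_comp)

text \<open>Well-formedness confines all related tuples to the universe, so the image depends only
  on the values of \<open>f\<close> there.\<close>

lemma img_cong:
  assumes "wf_struc ar M" "\<And>x. x \<in> s_univ M \<Longrightarrow> f x = g x"
  shows "img f M = img g M"
proof -
  have "map f ` s_rel M R = map g ` s_rel M R" for R
    using assms unfolding wf_struc_def by (intro image_cong) (auto intro!: map_cong)
  moreover have "f ` s_univ M = g ` s_univ M"
    using assms(2) by (intro image_cong) auto
  ultimately show ?thesis by (simp add: img_def)
qed

lemma img_id:
  fixes M :: "('a,'r) struc"
  assumes "wf_struc ar M" "\<And>x. x \<in> s_univ M \<Longrightarrow> f x = x"
  shows "img f M = M"
proof -
  have "img f M = img id M" using assms by (intro img_cong) auto
  then show ?thesis by (simp add: img_def)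
qed

lemma img_UnionS: "img f (UnionS C) = UnionS (img f ` C)"
  by (simp add: img_def UnionS_def image_UN)

lemma is_iso_img: "inj_on f (s_univ M) \<Longrightarrow> is_iso f M (img f M)"
  by (simp add: is_iso_def img_def bij_betw_def)

lemma is_iso_imp_img: "is_iso f M N \<Longrightarrow> N = img f M"
  for M N :: "('a,'r) struc"
  by (rule struc_eqI) (auto simp: is_iso_def img_def bij_betw_def)

lemma is_iso_inj: "is_iso f M N \<Longrightarrow> inj_on f (s_univ M)"
  by (simp add: is_iso_def bij_betw_def)

lemma wf_img: "wf_struc ar M \<Longrightarrow> wf_struc ar (img f M)"
  by (auto simp: wf_struc_def img_def)

lemma substruc_univ_eq:
  fixes M N :: "('a,'r) struc"
  assumes "substruc M N" "s_univ M = s_univ N" "wf_struc ar N"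
  shows "M = N"
proof (rule struc_eqI)
  show "s_rel M = s_rel N"
    using assms unfolding substruc_def wf_struc_def by (intro ext) blast
qed fact

text \<open>Points of \<open>B\<close> outside \<open>A\<close> go injectively to fresh points off
  the countable image of \<open>A\<close>. This is where the uncountable type is used: a countable
  model can be renamed with the position of a part of it prescribed.\<close>

lemma inj_on_extend:
  fixes h :: "'a \<Rightarrow> 'a"
  assumes unc: "\<not> countable (UNIV :: 'a set)" and "countable B" "A \<subseteq> B" "inj_on h A"
  obtains g where "inj_on g B" "\<And>x. x \<in> A \<Longrightarrow> g x = h x"
proof -
  have cA: "countable (h ` A)" using assms countable_subset by blast
  have "uncountable (UNIV - h ` A)" using unc cA by (rule uncountable_minus_countable)
  then have inf: "infinite (UNIV - h ` A)" using countable_finite by blast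
  have "countable (B - A)" using assms by simp
  then obtain e :: "'a \<Rightarrow> nat" where e: "inj_on e (B - A)" by (auto simp: countable_def)
  obtain k :: "nat \<Rightarrow> 'a" where k: "inj k" "range k \<subseteq> UNIV - h ` A"
    using inf infinite_countable_subset by blast
  define g where "g x = (if x \<in> A then h x else k (e x))" for x
  have "inj_on g B"
  proof (rule inj_onI)
    fix x y assume "x \<in> B" "y \<in> B" "g x = g y"
    then show "x = y"
      using k e assms(4) unfolding g_def
      by (cases "x \<in> A"; cases "y \<in> A") (auto dest: inj_onD injD)
  qed
  then show ?thesis by (rule that) (simp add: g_def)
qed

section \<open>Countable limit ordinals\<close>

text \<open>The field consists of natural numbers, so it enumerates itself: \<open>c (Suc n)\<close>
  is put above \<open>c n\<close> and, if \<open>n\<close> lies in the field, also above the number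
  \<open>n\<close>.\<close>

lemma wo_limit_cofinal:
  assumes "wo_limit r" "i0 \<in> Field r"
  obtains c :: "nat \<Rightarrow> nat" where "c 0 = i0" "\<And>n. (c n, c (Suc n)) \<in> r" "\<And>n. c n \<noteq> c (Suc n)"
    "\<And>n. c n \<in> Field r" "\<And>i. i \<in> Field r \<Longrightarrow> \<exists>n. (i, c n) \<in> r"
proof -
  have W: "Well_order r" using assms(1) by (simp add: wo_limit_def)
  have tr: "trans r" and as: "antisym r" and tot: "total_on (Field r) r" and rf: "Refl r"
    using W by (auto simp: well_order_on_def linear_order_on_def partial_order_on_def preorder_on_def)
  have up: "\<exists>y. y \<in> Field r \<and> (x,y) \<in> r \<and> x \<noteq> y" if "x \<in> Field r" for x
    using assms(1) that unfolding wo_limit_def by blast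
  have "\<exists>c. \<forall>n. (c n \<in> Field r \<and> (n = 0 \<longrightarrow> c n = i0)) \<and>
      ((c n, c (Suc n)) \<in> r \<and> c n \<noteq> c (Suc n) \<and> (n \<in> Field r \<longrightarrow> (n, c (Suc n)) \<in> r))"
  proof (rule dependent_nat_choice)
    show "\<exists>x. x \<in> Field r \<and> (0 = 0 \<longrightarrow> x = i0)" using assms(2) by blast
    fix x n :: nat assume "x \<in> Field r \<and> (n = 0 \<longrightarrow> x = i0)"
    then have x: "x \<in> Field r" by simp
    \<comment> \<open>\<open>z\<close> is the larger of \<open>x\<close> and \<open>n\<close> with
      respect to \<open>r\<close>, or \<open>x\<close> when \<open>n\<close> is outside the field;
      an element strictly above \<open>z\<close> meets both demands.\<close>
    obtain z where z: "z \<in> Field r" "(x,z) \<in> r" "n \<in> Field r \<longrightarrow> (n,z) \<in> r"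
    proof (cases "n \<in> Field r \<and> (x,n) \<in> r")
      case True
      then show ?thesis using rf by (intro that[of n]) (auto simp: refl_on_def)
    next
      case False
      then show ?thesis using rf x tot
        by (intro that[of x]) (auto simp: refl_on_def total_on_def, metis)
    qed
    obtain y where y: "y \<in> Field r" "(z,y) \<in> r" "z \<noteq> y" using up z by blast
    have "(x,y) \<in> r" using transD[OF tr z(2) y(2)] .
    moreover have "x \<noteq> y" using antisymD[OF as z(2)] y by auto
    moreover have "n \<in> Field r \<longrightarrow> (n,y) \<in> r" using z(3) transD[OF tr _ y(2)] by blast
    ultimately show "\<exists>y. (y \<in> Field r \<and> (Suc n = 0 \<longrightarrow> y = i0)) \<and> (x, y) \<in> r \<and> x \<noteq> y \<and> (n \<in> Field r \<longrightarrow> (n, y) \<in> r)"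
      using y(1) by auto
  qed
  then obtain c where c: "\<forall>n. (c n \<in> Field r \<and> (n = 0 \<longrightarrow> c n = i0)) \<and>
      ((c n, c (Suc n)) \<in> r \<and> c n \<noteq> c (Suc n) \<and> (n \<in> Field r \<longrightarrow> (n, c (Suc n)) \<in> r))" ..
  show ?thesis
  proof (rule that)
    show "c 0 = i0" "\<And>n. (c n, c (Suc n)) \<in> r" "\<And>n. c n \<noteq> c (Suc n)" "\<And>n. c n \<in> Field r"
      using c by blast+
    fix i assume "i \<in> Field r" then show "\<exists>n. (i, c n) \<in> r" using c by blast
  qed
qed

lemma wo_succ_exists:
  assumes "Well_order r" "(i,j) \<in> r" "i \<noteq> j"
  obtains s where "wo_succ r i s" "(s,j) \<in> r"
proof -
  have tr: "trans r" and as: "antisym r" and tot: "total_on (Field r) r" and w: "wf (r - Id)"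
    using assms(1) by (auto simp: well_order_on_def linear_order_on_def partial_order_on_def preorder_on_def)
  have rf: "Refl r" using assms(1)
    by (auto simp: well_order_on_def linear_order_on_def partial_order_on_def preorder_on_def)
  have "j \<in> {k. (i,k) \<in> r \<and> k \<noteq> i}" using assms by simp
  from wfE_min[OF w this] obtain s where s: "(i,s) \<in> r" "s \<noteq> i"
    "\<And>y. (y,s) \<in> r - Id \<Longrightarrow> \<not> ((i,y) \<in> r \<and> y \<noteq> i)" by auto
  have "wo_succ r i s" unfolding wo_succ_def using s by auto
  moreover have "(s,j) \<in> r"
  proof (cases "s = j")
    case True
    then show ?thesis using rf s(1) by (auto simp: refl_on_def Field_def)
  next
    case False
    have "s \<in> Field r" "j \<in> Field r" using s(1) assms(2) by (auto simp: Field_def)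
    then have "(s,j) \<in> r \<or> (j,s) \<in> r" using tot False by (auto simp: total_on_def)
    then show ?thesis using s(3)[of j] False assms by auto
  qed
  ultimately show ?thesis by (rule that)
qed

lemma natLeq_wo_limit: "wo_limit natLeq"
proof -
  have "\<exists>j\<in>Field natLeq. (i, j) \<in> natLeq \<and> i \<noteq> j" for i
    by (rule bexI[of _ "Suc i"]) (simp_all only: Field_natLeq UNIV_I, simp add: natLeq_def)
  moreover have "Field natLeq \<noteq> {}" by (simp only: Field_natLeq UNIV_not_empty not_False_eq_True)
  ultimately show ?thesis unfolding wo_limit_def using natLeq_Well_order by (intro conjI ballI)
qed

lemma natLeq_wo_min: "wo_min natLeq 0"
  unfolding wo_min_def Field_natLeq by (simp add: natLeq_def)

lemma natLeq_wo_succ: "wo_succ natLeq i j \<longleftrightarrow> j = Suc i"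
proof
  assume w: "wo_succ natLeq i j"
  then have "i \<le> j" "i \<noteq> j" and *: "\<And>k. i \<le> k \<Longrightarrow> k \<le> j \<Longrightarrow> k = i \<or> k = j"
    by (auto simp: wo_succ_def natLeq_def)
  then have "Suc i \<le> j" by simp
  then show "j = Suc i" using *[of "Suc i"] by simp
qed (auto simp: wo_succ_def natLeq_def)

text \<open>This makes continuity vacuous for chains along \<open>natLeq\<close>.\<close>

lemma natLeq_no_wo_limpt: "\<not> wo_limpt natLeq i"
proof
  assume "wo_limpt natLeq i"
  then have "\<not> wo_min natLeq i" "\<And>j. i \<noteq> Suc j" by (auto simp: wo_limpt_def natLeq_wo_succ)
  then show False using natLeq_wo_min by (cases i) auto
qed

section \<open>Embeddings and amalgamation\<close>

text \<open>Amalgamation is the only part of superstability assumed at this stage; stability and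
  categoricity appear as explicit premises where universal and limit models are built.\<close>

locale countable_aec =
  fixes ar :: "'r \<Rightarrow> nat"
    and K :: "('a,'r) struc set"
    and le :: "('a,'r) struc \<Rightarrow> ('a,'r) struc \<Rightarrow> bool"
  assumes uncountable_UNIV: "\<not> countable (UNIV :: 'a set)"
    and aec: "aec ar K le"
    and ls: "ls_le_aleph0 ar K le"
    and ap: "ap_c K le"
begin

abbreviation "emb \<equiv> kemb K le"
abbreviation "univ_over \<equiv> universal_over K le"
abbreviation "lim_over \<equiv> limit_over K le"

lemma wf: "M \<in> K \<Longrightarrow> wf_struc ar M"
  using aec[unfolded aec_def, THEN conjunct1] by blast

lemma le_in: "le M N \<Longrightarrow> M \<in> K" "le M N \<Longrightarrow> N \<in> K"
  using aec[unfolded aec_def, THEN conjunct2, THEN conjunct2, THEN conjunct1] by blast+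

lemma le_refl: "M \<in> K \<Longrightarrow> le M M"
  using aec[unfolded aec_def, THEN conjunct2, THEN conjunct2, THEN conjunct2, THEN conjunct1] by blast

lemma le_trans: "le M N \<Longrightarrow> le N P \<Longrightarrow> le M P"
  using aec[unfolded aec_def, THEN conjunct2, THEN conjunct2, THEN conjunct2, THEN conjunct2, THEN conjunct1] by blast

lemma le_substruc: "le M N \<Longrightarrow> substruc M N"
  using aec[unfolded aec_def, THEN conjunct2, THEN conjunct2, THEN conjunct2, THEN conjunct2, THEN conjunct2, THEN conjunct1] by blast

lemma le_univ: "le M N \<Longrightarrow> s_univ M \<subseteq> s_univ N"
  using le_substruc by (auto simp: substruc_def)

lemma coherence:
  assumes "le M0 M2" "le M1 M2" "s_univ M0 \<subseteq> s_univ M1"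
  shows "le M0 M1"
proof -
  have "substruc M0 M1"
    using le_substruc[OF assms(1)] le_substruc[OF assms(2)] assms(3) unfolding substruc_def by auto
  then show ?thesis
    using aec[unfolded aec_def, THEN conjunct2, THEN conjunct2, THEN conjunct2, THEN conjunct2, THEN conjunct2, THEN conjunct2, THEN conjunct2, THEN conjunct1] assms le_in by blast
qed

lemma img_in: "M \<in> K \<Longrightarrow> inj_on f (s_univ M) \<Longrightarrow> img f M \<in> K"
  using aec[unfolded aec_def, THEN conjunct2, THEN conjunct1] is_iso_img wf_img wf by blast

lemma img_le:
  assumes "le M N" "inj_on f (s_univ N)"
  shows "le (img f M) (img f N)"
  using aec[unfolded aec_def, THEN conjunct2, THEN conjunct2, THEN conjunct2, THEN conjunct2, THEN conjunct2, THEN conjunct2, THEN conjunct1] assms img_in is_iso_img le_in by blast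

lemma Kc_in: "M \<in> Kc K \<Longrightarrow> M \<in> K"
  by (simp add: Kc_def)

lemma Kc_img: "M \<in> Kc K \<Longrightarrow> inj_on f (s_univ M) \<Longrightarrow> img f M \<in> Kc K"
  using img_in by (auto simp: Kc_def finite_image_iff)

lemma Kc_countable: "M \<in> Kc K \<Longrightarrow> countable (s_univ M)"
  by (simp add: Kc_def)

lemma union_chain:
  assumes "C \<noteq> {}" "C \<subseteq> K" "\<And>M N. M \<in> C \<Longrightarrow> N \<in> C \<Longrightarrow> le M N \<or> le N M"
  shows "UnionS C \<in> K" "M \<in> C \<Longrightarrow> le M (UnionS C)" "(\<And>M. M \<in> C \<Longrightarrow> le M N) \<Longrightarrow> le (UnionS C) N"
proof -
  note ax = aec[unfolded aec_def, THEN conjunct2, THEN conjunct2, THEN conjunct2, THEN conjunct2, THEN conjunct2, THEN conjunct2, THEN conjunct2, THEN conjunct2]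
  from ax[rule_format, of C] assms
  show "UnionS C \<in> K" "M \<in> C \<Longrightarrow> le M (UnionS C)" "(\<And>M. M \<in> C \<Longrightarrow> le M N) \<Longrightarrow> le (UnionS C) N"
    by auto
qed

lemma chain_le:
  fixes Q :: "nat \<Rightarrow> ('a,'r) struc"
  assumes "\<And>n. le (Q n) (Q (Suc n))" "m \<le> n"
  shows "le (Q m) (Q n)"
  using assms(2)
proof (induction n rule: dec_induct)
  case base
  then show ?case using assms(1) le_in le_refl by blast
next
  case (step n)
  then show ?case using assms(1) le_trans by blast
qed

lemma omega_chain:
  fixes Q :: "nat \<Rightarrow> ('a,'r) struc"
  assumes "\<And>n. le (Q n) (Q (Suc n))"
  shows "UnionS (range Q) \<in> K" "le (Q n) (UnionS (range Q))"
    "(\<And>n. le (Q n) N) \<Longrightarrow> le (UnionS (range Q)) N"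
proof -
  have *: "range Q \<noteq> {}" "range Q \<subseteq> K" using assms le_in by auto
  have **: "le M N \<or> le N M" if "M \<in> range Q" "N \<in> range Q" for M N
    using that chain_le[of Q, OF assms] nat_le_linear by blast
  show "UnionS (range Q) \<in> K" "le (Q n) (UnionS (range Q))"
    "(\<And>n. le (Q n) N) \<Longrightarrow> le (UnionS (range Q)) N"
    using union_chain[OF * **] by blast+
qed

lemma omega_chain_Kc:
  fixes Q :: "nat \<Rightarrow> ('a,'r) struc"
  assumes "\<And>n. le (Q n) (Q (Suc n))" "\<And>n. Q n \<in> Kc K"
  shows "UnionS (range Q) \<in> Kc K"
proof -
  have "infinite (s_univ (UnionS (range Q)))"
    using assms(2)[of 0] infinite_super[of "s_univ (Q 0)" "s_univ (UnionS (range Q))"]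
    by (auto simp: Kc_def)
  then show ?thesis using omega_chain(1)[of Q, OF assms(1)] assms(2) by (auto simp: Kc_def)
qed

text \<open>The Lowenheim-Skolem bound only keeps the model countable; including the universe of a
  model \<open>M\<close> from \<open>Kc K\<close> keeps it infinite.\<close>

lemma Kc_between:
  assumes "N \<in> K" "A \<subseteq> s_univ N" "countable A" "M \<in> Kc K" "s_univ M \<subseteq> s_univ N"
  obtains N' where "N' \<in> Kc K" "le N' N" "A \<subseteq> s_univ N'" "s_univ M \<subseteq> s_univ N'"
proof -
  let ?A = "A \<union> s_univ M"
  have "?A \<subseteq> s_univ N" using assms by auto
  then obtain N' where N': "le N' N" "?A \<subseteq> s_univ N'" "s_univ N' \<lesssim> ?A <+> (UNIV :: nat set)"
    using ls assms(1) unfolding ls_le_aleph0_def by blast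
  have "countable (?A <+> (UNIV :: nat set))"
    using assms Kc_countable by (auto simp: Plus_def)
  then have "countable (s_univ N')" using N'(3)
    by (meson countable_image countable_subset lepoll_iff)
  moreover have "infinite (s_univ N')" using assms(4) N'(2) finite_subset by (auto simp: Kc_def)
  ultimately have "N' \<in> Kc K" using N' le_in by (auto simp: Kc_def)
  then show ?thesis using that N' by auto
qed

lemma embD:
  assumes "emb f M N"
  shows "M \<in> K" "N \<in> K" "inj_on f (s_univ M)" "le (img f M) N" "f ` s_univ M \<subseteq> s_univ N"
    "\<And>x. x \<in> s_univ M \<Longrightarrow> f x \<in> s_univ N"
  using assms le_univ[of "img f M" N] unfolding kemb_def by auto

lemma emb_comp:
  assumes "emb f M N" "emb g N P"
  shows "emb (g \<circ> f) M P"
proof -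
  have "le (img g (img f M)) (img g N)"
    by (rule img_le[OF embD(4)[OF assms(1)] embD(3)[OF assms(2)]])
  then have "le (img (g \<circ> f) M) P" using le_trans embD(4)[OF assms(2)] by (simp add: img_img)
  moreover have "inj_on (g \<circ> f) (s_univ M)"
    by (rule comp_inj_on[OF embD(3)[OF assms(1)] inj_on_subset[OF embD(3)[OF assms(2)] embD(5)[OF assms(1)]]])
  ultimately show ?thesis using assms unfolding kemb_def by auto
qed

lemma emb_id: "le M N \<Longrightarrow> emb id M N"
  using le_in wf img_id[of ar M id] unfolding kemb_def by auto

lemma emb_le1: "le M N \<Longrightarrow> emb f N P \<Longrightarrow> emb f M P"
  using emb_comp[OF emb_id] by fastforce

lemma emb_le2: "emb f M N \<Longrightarrow> le N P \<Longrightarrow> emb f M P"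
  using le_trans[of "img f M" N P] le_in[of N P] by (simp add: kemb_def)

lemma emb_cut: "emb f M N \<Longrightarrow> le N' N \<Longrightarrow> f ` s_univ M \<subseteq> s_univ N' \<Longrightarrow> emb f M N'"
  using coherence[of "img f M" N N'] le_in[of N' N] by (simp add: kemb_def)

lemma emb_img: "M \<in> K \<Longrightarrow> inj_on f (s_univ M) \<Longrightarrow> emb f M (img f M)"
  unfolding kemb_def using img_in le_refl by blast

lemma emb_iso: "M \<in> K \<Longrightarrow> is_iso f M N \<Longrightarrow> emb f M N"
  using emb_img is_iso_imp_img is_iso_inj by metis

lemma iso_Kc: "M \<in> Kc K \<Longrightarrow> is_iso f M N \<Longrightarrow> N \<in> Kc K"
  using Kc_img is_iso_imp_img is_iso_inj by metis

lemma emb_img_inv: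
  assumes "emb f M N"
  shows "img (inv_into (s_univ M) f) (img f M) = M"
proof -
  have "img (inv_into (s_univ M) f \<circ> f) M = M"
    using embD[OF assms] by (intro img_id[OF wf]) auto
  then show ?thesis by (simp add: img_img)
qed

text \<open>This is the usual reduction to inclusions: inverting \<open>f\<close> on its image and
  renaming the rest of \<open>N'\<close> afresh turns \<open>N'\<close> into an extension of
  \<open>M\<close>.\<close>

lemma emb_extend_inverse:
  assumes "emb f M N" "le N N'" "N' \<in> Kc K"
  obtains k where "inj_on k (s_univ N')" "\<And>x. x \<in> s_univ M \<Longrightarrow> k (f x) = x"
    "img k N' \<in> Kc K" "le M (img k N')" "emb k N' (img k N')" "img k (img f M) = M"
proof -
  note f = embD[OF assms(1)]
  have sub: "f ` s_univ M \<subseteq> s_univ N'" using f le_univ assms(2) by blast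
  have inj: "inj_on (inv_into (s_univ M) f) (f ` s_univ M)" by (simp add: inj_on_inv_into)
  obtain k where k: "inj_on k (s_univ N')"
    "\<And>x. x \<in> f ` s_univ M \<Longrightarrow> k x = inv_into (s_univ M) f x"
    using inj_on_extend[OF uncountable_UNIV Kc_countable[OF assms(3)] sub inj] by blast
  have kf: "k (f x) = x" if "x \<in> s_univ M" for x using that k f by auto
  have eq: "img k (img f M) = M" unfolding img_img
    using f(1) kf by (intro img_id[OF wf]) auto
  have "le (img k (img f M)) (img k N')"
    by (rule img_le[OF le_trans[OF f(4) assms(2)] k(1)])
  then have "le M (img k N')" using eq by simp
  then show ?thesis
    using that[OF k(1) kf Kc_img[OF assms(3) k(1)] _ emb_img[OF Kc_in[OF assms(3)] k(1)] eq] by blast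
qed

text \<open>Dually, the part of \<open>M'\<close> outside \<open>M\<close> is renamed afresh, so
  that \<open>f\<close> extends to an isomorphism onto a copy of \<open>M'\<close>, which need not
  lie in \<open>N\<close>.\<close>

lemma emb_extend:
  assumes "emb f M N" "M \<in> Kc K" "M' \<in> Kc K" "le M M'"
  obtains g where "inj_on g (s_univ M')" "\<And>x. x \<in> s_univ M \<Longrightarrow> g x = f x"
    "img g M' \<in> Kc K" "le (img f M) (img g M')" "emb g M' (img g M')"
proof -
  obtain g where g: "inj_on g (s_univ M')" "\<And>x. x \<in> s_univ M \<Longrightarrow> g x = f x"
    using inj_on_extend[OF uncountable_UNIV Kc_countable[OF assms(3)] le_univ[OF assms(4)]
      embD(3)[OF assms(1)]] by blast
  have "img g M = img f M" using assms(2) Kc_in g by (intro img_cong[OF wf]) auto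
  then have "le (img f M) (img g M')" using img_le[OF assms(4) g(1)] by simp
  then show ?thesis
    using that[OF g Kc_img[OF assms(3) g(1)] _ emb_img[OF Kc_in[OF assms(3)] g(1)]] by blast
qed

text \<open>The axiom amalgamates over an inclusion, so \<open>M1\<close> and \<open>M2\<close> are
  renamed into extensions of \<open>M0\<close>; renaming the amalgam \<open>P\<close> once more by
  \<open>m\<close> makes it extend \<open>M1\<close>.\<close>

lemma amalgamation:
  assumes "M0 \<in> Kc K" "M1 \<in> Kc K" "M2 \<in> Kc K" "emb f1 M0 M1" "emb f2 M0 M2"
  obtains N g where "N \<in> Kc K" "le M1 N" "emb g M2 N" "\<And>x. x \<in> s_univ M0 \<Longrightarrow> g (f2 x) = f1 x"
proof -
  obtain k1 where k1: "\<And>x. x \<in> s_univ M0 \<Longrightarrow> k1 (f1 x) = x" "img k1 M1 \<in> Kc K"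
    "le M0 (img k1 M1)" "emb k1 M1 (img k1 M1)"
    using emb_extend_inverse[OF assms(4) le_refl[OF Kc_in[OF assms(2)]] assms(2)] by metis
  obtain k2 where k2: "\<And>x. x \<in> s_univ M0 \<Longrightarrow> k2 (f2 x) = x" "img k2 M2 \<in> Kc K"
    "le M0 (img k2 M2)" "emb k2 M2 (img k2 M2)"
    using emb_extend_inverse[OF assms(5) le_refl[OF Kc_in[OF assms(3)]] assms(3)] by metis
  obtain P h1 h2 where P: "P \<in> Kc K" "emb h1 (img k1 M1) P" "emb h2 (img k2 M2) P"
    "\<And>x. x \<in> s_univ M0 \<Longrightarrow> h1 x = h2 x"
    using ap[unfolded ap_c_def, rule_format, OF assms(1) k1(2) k2(2)] k1(3) k2(3) by blast
  have e1: "emb (h1 \<circ> k1) M1 P" and e2: "emb (h2 \<circ> k2) M2 P"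
    using emb_comp[OF k1(4) P(2)] emb_comp[OF k2(4) P(3)] by blast+
  obtain m where m: "\<And>x. x \<in> s_univ M1 \<Longrightarrow> m ((h1 \<circ> k1) x) = x" "img m P \<in> Kc K"
    "le M1 (img m P)" "emb m P (img m P)"
    using emb_extend_inverse[OF e1 le_refl[OF Kc_in[OF P(1)]] P(1)] by metis
  show ?thesis
  proof (rule that[OF m(2,3)])
    show "emb (m \<circ> (h2 \<circ> k2)) M2 (img m P)" by (rule emb_comp[OF e2 m(4)])
    fix x assume x: "x \<in> s_univ M0"
    then have "f1 x \<in> s_univ M1" by (rule embD(6)[OF assms(4)])
    then have "m (h1 (k1 (f1 x))) = f1 x" using m(1) by fastforce
    then show "(m \<circ> (h2 \<circ> k2)) (f2 x) = f1 x" using x k1 k2 P(4)[OF x] by simp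
  qed
qed

lemma amalgamation_le:
  assumes "M0 \<in> Kc K" "M1 \<in> Kc K" "M2 \<in> Kc K" "le M0 M1" "le M0 M2"
  obtains N g where "N \<in> Kc K" "le M1 N" "emb g M2 N" "\<And>x. x \<in> s_univ M0 \<Longrightarrow> g x = x"
  using amalgamation[OF assms(1-3) emb_id[OF assms(4)] emb_id[OF assms(5)]] by (metis id_apply)

section \<open>Galois types\<close>

text \<open>For \<open>h\<close> an isomorphism of a model with universe \<open>X\<close> onto a submodel of \<open>N'\<close>, this says that \<open>h\<close>
  maps \<open>gtp(a/X;N)\<close> to \<open>gtp(b/h[X];N')\<close>. All models involved are countable, so by amalgamation a
  single pair of embeddings suffices and no transitive closure is needed.\<close>

definition tp_match where
  "tp_match h X a N b N' \<longleftrightarrow> N \<in> Kc K \<and> N' \<in> Kc K \<and> a \<in> s_univ N \<and> b \<in> s_univ N' \<and>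
     X \<subseteq> s_univ N \<and> h ` X \<subseteq> s_univ N' \<and>
     (\<exists>P f1 f2. P \<in> Kc K \<and> emb f1 N P \<and> emb f2 N' P \<and> (\<forall>x\<in>X. f1 x = f2 (h x)) \<and> f1 a = f2 b)"

lemma tp_matchD:
  assumes "tp_match h X a N b N'"
  shows "N \<in> Kc K" "N' \<in> Kc K" "a \<in> s_univ N" "b \<in> s_univ N'" "X \<subseteq> s_univ N" "h ` X \<subseteq> s_univ N'"
  using assms by (simp_all add: tp_match_def)

lemma tp_match_emb:
  assumes "N \<in> Kc K" "N' \<in> Kc K" "a \<in> s_univ N" "X \<subseteq> s_univ N" "emb g N N'" "\<And>x. x \<in> X \<Longrightarrow> g x = h x"
  shows "tp_match h X a N (g a) N'"
proof -
  have "h ` X \<subseteq> s_univ N'" using assms(4,6) embD(6)[OF assms(5)] by force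
  then show ?thesis unfolding tp_match_def
    using assms emb_id[OF le_refl[OF Kc_in[OF assms(2)]]] embD(6)[OF assms(5,3)]
    by (intro conjI exI[of _ N'] exI[of _ g] exI[of _ id]) auto
qed

lemma tp_match_le: "N \<in> Kc K \<Longrightarrow> N' \<in> Kc K \<Longrightarrow> le N N' \<Longrightarrow> a \<in> s_univ N \<Longrightarrow> X \<subseteq> s_univ N \<Longrightarrow> tp_match id X a N a N'"
  using tp_match_emb[of N N' a X id id] emb_id by simp

lemma tp_match_refl: "N \<in> Kc K \<Longrightarrow> a \<in> s_univ N \<Longrightarrow> X \<subseteq> s_univ N \<Longrightarrow> tp_match id X a N a N"
  using tp_match_le le_refl Kc_in by simp

lemma tp_match_inv:
  assumes "tp_match h X a N b N'" "\<And>y. y \<in> Y \<Longrightarrow> k y \<in> X \<and> h (k y) = y"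
  shows "tp_match k Y b N' a N"
proof -
  obtain P f1 f2 where P: "P \<in> Kc K" "emb f1 N P" "emb f2 N' P" "\<forall>x\<in>X. f1 x = f2 (h x)" "f1 a = f2 b"
    using assms(1) unfolding tp_match_def by blast
  have "\<forall>y\<in>Y. f2 y = f1 (k y)" using P(4) assms(2) by simp
  moreover have "Y \<subseteq> s_univ N'" "k ` Y \<subseteq> s_univ N" using assms(2) tp_matchD(5,6)[OF assms(1)] by force+
  ultimately show ?thesis unfolding tp_match_def using P tp_matchD[OF assms(1)] by metis
qed

lemma tp_match_sym: "tp_match id X a N b N' \<Longrightarrow> tp_match id X b N' a N"
  by (erule tp_match_inv[where k = id]) simp

text \<open>Amalgamating the two witnesses over the middle model \<open>N'\<close> makes both images
  of \<open>b\<close> coincide. The map \<open>k\<close> is only required to agree with the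
  composite on \<open>X\<close>.\<close>

lemma tp_match_trans:
  assumes "tp_match h X a N b N'" "tp_match h' Y b N' c N''" "\<And>x. x \<in> X \<Longrightarrow> h x \<in> Y \<and> h' (h x) = k x"
  shows "tp_match k X a N c N''"
proof -
  obtain P f1 f2 where P: "P \<in> Kc K" "emb f1 N P" "emb f2 N' P" "\<forall>x\<in>X. f1 x = f2 (h x)" "f1 a = f2 b"
    using assms(1) unfolding tp_match_def by blast
  obtain P' g1 g2 where P': "P' \<in> Kc K" "emb g1 N' P'" "emb g2 N'' P'" "\<forall>x\<in>Y. g1 x = g2 (h' x)" "g1 b = g2 c"
    using assms(2) unfolding tp_match_def by blast
  note D = tp_matchD[OF assms(1)] tp_matchD[OF assms(2)]
  obtain Q m where Q: "Q \<in> Kc K" "le P Q" "emb m P' Q" "\<And>x. x \<in> s_univ N' \<Longrightarrow> m (g1 x) = f2 x"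
    using amalgamation[OF D(2) P(1) P'(1) P(3) P'(2)] by blast
  have 1: "emb f1 N Q" by (rule emb_le2[OF P(2) Q(2)])
  have 2: "emb (m \<circ> g2) N'' Q" by (rule emb_comp[OF P'(3) Q(3)])
  have 3: "f1 x = (m \<circ> g2) (k x)" "k x \<in> s_univ N''" if "x \<in> X" for x
  proof -
    have hx: "h x \<in> Y" "k x = h' (h x)" using assms(3)[OF that] by auto
    then have "h x \<in> s_univ N'" using D(11) by auto
    then show "f1 x = (m \<circ> g2) (k x)" using P(4) P'(4) Q(4) that hx by force
    show "k x \<in> s_univ N''" using hx D(12) by auto
  qed
  have 4: "f1 a = (m \<circ> g2) c" using P(5) P'(5) Q(4)[OF D(4)] by simp
  have "\<exists>P f1 f2. P \<in> Kc K \<and> emb f1 N P \<and> emb f2 N'' P \<and> (\<forall>x\<in>X. f1 x = f2 (k x)) \<and> f1 a = f2 c"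
    by (rule exI[of _ Q], rule exI[of _ f1], rule exI[of _ "m \<circ> g2"]) (intro conjI ballI Q(1) 1 2 3(1) 4)
  moreover have "k ` X \<subseteq> s_univ N''" by (rule image_subsetI) (rule 3(2))
  ultimately show ?thesis unfolding tp_match_def using D(1,3,5,8,10) by (intro conjI)
qed

lemma tp_match_mono:
  assumes "tp_match h X a N b N'" "Y \<subseteq> X"
  shows "tp_match h Y a N b N'"
proof (rule tp_match_trans[OF tp_match_refl assms(1)])
  show "N \<in> Kc K" "a \<in> s_univ N" "Y \<subseteq> s_univ N" using tp_matchD(1,3,5)[OF assms(1)] assms(2) by auto
qed (use assms(2) in auto)

section \<open>Equality of Galois types as a match inside countable models\<close>

lemma gtp_eq_valid: "gtp_eq K le M t t' \<Longrightarrow> valid_tr K le M t" "gtp_eq K le M t t' \<Longrightarrow> valid_tr K le M t'"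
proof -
  have "valid_tr K le M t'" if "(\<lambda>x y. valid_tr K le M x \<and> valid_tr K le M y \<and> E_at K le M x y)\<^sup>*\<^sup>* t t'"
    "valid_tr K le M t" using that by (cases rule: rtranclp.cases) auto
  then show "gtp_eq K le M t t' \<Longrightarrow> valid_tr K le M t" "gtp_eq K le M t t' \<Longrightarrow> valid_tr K le M t'"
    unfolding gtp_eq_def by auto
qed

lemma gtp_eq_refl: "valid_tr K le M t \<Longrightarrow> gtp_eq K le M t t"
  by (simp add: gtp_eq_def)

lemma gtp_eq_trans: "gtp_eq K le M t u \<Longrightarrow> gtp_eq K le M u v \<Longrightarrow> gtp_eq K le M t v"
  unfolding gtp_eq_def by (meson rtranclp_trans)

lemma E_at_sym: "E_at K le M t u \<Longrightarrow> E_at K le M u t"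
  unfolding E_at_def by metis

lemma gtp_eq_sym:
  assumes "gtp_eq K le M t u" shows "gtp_eq K le M u t"
proof -
  let ?R = "\<lambda>x y. valid_tr K le M x \<and> valid_tr K le M y \<and> E_at K le M x y"
  have "?R\<^sup>*\<^sup>* t u" using assms by (simp add: gtp_eq_def)
  then have "?R\<^sup>*\<^sup>* u t"
  proof (induction rule: rtranclp_induct)
    case (step y z)
    then have "?R z y" using E_at_sym by blast
    then show ?case using step.IH by (rule converse_rtranclp_into_rtranclp)
  qed simp
  then show ?thesis using gtp_eq_valid[OF assms] by (simp add: gtp_eq_def)
qed

lemma gtp_eq_step: "valid_tr K le M t \<Longrightarrow> valid_tr K le M u \<Longrightarrow> E_at K le M t u \<Longrightarrow> gtp_eq K le M t u"
  by (simp add: gtp_eq_def r_into_rtranclp)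

lemma gtp_eq_mono:
  assumes "gtp_eq K le M t u" "le M0 M"
  shows "gtp_eq K le M0 t u"
proof -
  have v: "valid_tr K le M0 x" if "valid_tr K le M x" for x
    using that le_trans[OF assms(2)] unfolding valid_tr_def by blast
  have E: "E_at K le M0 x y" if "E_at K le M x y" for x y
    using that le_univ[OF assms(2)] unfolding E_at_def by blast
  have "(\<lambda>x y. valid_tr K le M0 x \<and> valid_tr K le M0 y \<and> E_at K le M0 x y)\<^sup>*\<^sup>* t u"
    by (rule rtranclp_mono[THEN predicate2D, rotated, OF assms(1)[unfolded gtp_eq_def, THEN conjunct2]])
       (auto intro: v E)
  then show ?thesis using v gtp_eq_valid[OF assms(1)] by (simp add: gtp_eq_def)
qed

lemma gtp_eqI: "gtp_eq K le M (a,N) (b,N') \<Longrightarrow> gtp K le M a N = gtp K le M b N'"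
  unfolding gtp_def using gtp_eq_sym gtp_eq_trans by blast

lemma gtp_eqD: "gtp K le M a N = gtp K le M b N' \<Longrightarrow> le M N' \<Longrightarrow> b \<in> s_univ N' \<Longrightarrow> gtp_eq K le M (a,N) (b,N')"
  using gtp_eq_refl[of M "(b,N')"] unfolding gtp_def valid_tr_def by auto

lemma gtp_le:
  assumes "le M N" "le N N'" "a \<in> s_univ N"
  shows "gtp K le M a N = gtp K le M a N'"
proof (rule gtp_eqI, rule gtp_eq_step)
  show "valid_tr K le M (a,N)" "valid_tr K le M (a,N')"
    using assms le_trans[OF assms(1,2)] le_univ[OF assms(2)] by (auto simp: valid_tr_def)
  show "E_at K le M (a, N) (a, N')" unfolding E_at_def
    using emb_id[OF assms(2)] emb_id[OF le_refl[OF le_in(2)[OF assms(2)]]] by fastforce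
qed

lemma Kc_below:
  assumes "le M N" "M \<in> Kc K" "a \<in> s_univ N"
  obtains N' where "N' \<in> Kc K" "le M N'" "le N' N" "a \<in> s_univ N'"
proof -
  obtain N' where "N' \<in> Kc K" "le N' N" "{a} \<subseteq> s_univ N'" "s_univ M \<subseteq> s_univ N'"
    using Kc_between[OF le_in(2)[OF assms(1)] _ _ assms(2) le_univ[OF assms(1)], of "{a}"] assms(3)
    by auto
  then show ?thesis using that coherence[OF assms(1)] by auto
qed

text \<open>The common target \<open>P\<close> may be uncountable; a countable submodel
  \<open>Q\<close> containing both images still receives both embeddings, by coherence.\<close>

lemma E_at_tp_match:
  assumes "E_at K le M (a,N) (b,N')" "N0 \<in> Kc K" "N0' \<in> Kc K" "le N0 N" "le N0' N'"
    and ab: "a \<in> s_univ N0" "b \<in> s_univ N0'" "s_univ M \<subseteq> s_univ N0" "s_univ M \<subseteq> s_univ N0'"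
  shows "tp_match id (s_univ M) a N0 b N0'"
proof -
  obtain P f1 f2 where P: "emb f1 N P" "emb f2 N' P" "\<forall>x\<in>s_univ M. f1 x = f2 x" "f1 a = f2 b"
    using assms(1) unfolding E_at_def by auto
  have e1: "emb f1 N0 P" by (rule emb_le1[OF assms(4) P(1)])
  have e2: "emb f2 N0' P" by (rule emb_le1[OF assms(5) P(2)])
  obtain Q where Q: "Q \<in> Kc K" "le Q P" "f1 ` s_univ N0 \<subseteq> s_univ Q" "s_univ (img f2 N0') \<subseteq> s_univ Q"
    using Kc_between[OF embD(2)[OF e1] embD(5)[OF e1] countable_image[OF Kc_countable[OF assms(2)]]
      Kc_img[OF assms(3) embD(3)[OF e2]]] le_univ[OF embD(4)[OF e2]] by blast
  have "emb f1 N0 Q" "emb f2 N0' Q" using emb_cut[OF e1 Q(2)] emb_cut[OF e2 Q(2)] Q by auto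
  then show ?thesis unfolding tp_match_def using P Q assms ab by auto
qed

text \<open>Induction along the chain of atomic steps. Intermediate models may be uncountable, so
  each is replaced by a countable submodel \<open>N0\<close>; the model \<open>N'\<close> is kept
  arbitrary so that the induction hypothesis applies to that choice.\<close>

lemma gtp_eq_imp_tp_match:
  assumes "gtp_eq K le M (a,N) t" "M \<in> Kc K" "N \<in> Kc K"
    and "N' \<in> Kc K" "le M N'" "le N' (snd t)" "fst t \<in> s_univ N'"
  shows "tp_match id (s_univ M) a N (fst t) N'"
proof -
  let ?R = "\<lambda>x y. valid_tr K le M x \<and> valid_tr K le M y \<and> E_at K le M x y"
  have v: "le M N" "a \<in> s_univ N" using gtp_eq_valid(1)[OF assms(1)] by (auto simp: valid_tr_def)
  have "?R\<^sup>*\<^sup>* (a,N) t" using assms(1) by (simp add: gtp_eq_def)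
  then show ?thesis using assms(4-)
  proof (induction arbitrary: N' rule: rtranclp_induct)
    case base
    have "tp_match id (s_univ M) a N' a N"
      using base v le_univ[OF base(2)] by (intro tp_match_le assms) auto
    then show ?case by (simp only: fst_conv tp_match_sym)
  next
    case (step t u)
    then have t: "le M (snd t)" "fst t \<in> s_univ (snd t)" "E_at K le M (fst t, snd t) (fst u, snd u)"
      by (auto simp: valid_tr_def)
    obtain N0 where N0: "N0 \<in> Kc K" "le M N0" "le N0 (snd t)" "fst t \<in> s_univ N0"
      using Kc_below[OF t(1) assms(2) t(2)] by blast
    have "tp_match id (s_univ M) (fst t) N0 (fst u) N'"
      by (rule E_at_tp_match[OF t(3) N0(1) step.prems(1) N0(3) step.prems(3) N0(4) step.prems(4)
          le_univ[OF N0(2)] le_univ[OF step.prems(2)]])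
    with step.IH[OF N0] show ?case by (rule tp_match_trans) auto
  qed
qed

lemma tp_match_imp_gtp_eq:
  assumes "tp_match id (s_univ M) a N b N'" "le M N" "le M N'"
  shows "gtp_eq K le M (a,N) (b,N')"
proof (rule gtp_eq_step)
  show "valid_tr K le M (a,N)" "valid_tr K le M (b,N')"
    using assms tp_matchD[OF assms(1)] by (auto simp: valid_tr_def)
  show "E_at K le M (a,N) (b,N')" using assms(1) unfolding tp_match_def E_at_def by auto
qed

lemma gtp_eq_iff_tp_match:
  assumes "M \<in> Kc K" "N \<in> Kc K" "N' \<in> Kc K" "le M N" "le M N'" "a \<in> s_univ N" "b \<in> s_univ N'"
  shows "gtp K le M a N = gtp K le M b N' \<longleftrightarrow> tp_match id (s_univ M) a N b N'"
proof
  assume "gtp K le M a N = gtp K le M b N'"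
  then have "gtp_eq K le M (a,N) (b,N')" using gtp_eqD assms by blast
  from gtp_eq_imp_tp_match[OF this assms(1,2,3,5)] show "tp_match id (s_univ M) a N b N'"
    using assms le_refl[OF Kc_in] by auto
next
  assume "tp_match id (s_univ M) a N b N'"
  then show "gtp K le M a N = gtp K le M b N'" using tp_match_imp_gtp_eq gtp_eqI assms by blast
qed

lemma gS_Kc:
  assumes "p \<in> gS K le M" "M \<in> Kc K"
  obtains a N where "N \<in> Kc K" "le M N" "a \<in> s_univ N" "p = gtp K le M a N"
proof -
  obtain a N where N: "p = gtp K le M a N" "le M N" "a \<in> s_univ N" using assms unfolding gS_def by blast
  obtain N' where N': "N' \<in> Kc K" "le M N'" "le N' N" "a \<in> s_univ N'"
    using Kc_below[OF N(2) assms(2) N(3)] by blast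
  show ?thesis using that[OF N'(1,2,4)] gtp_le[OF N'(2,3,4)] N by simp
qed

lemma gtp_in_gS: "le M N \<Longrightarrow> a \<in> s_univ N \<Longrightarrow> gtp K le M a N \<in> gS K le M"
  unfolding gS_def by blast

lemma tp_match_nonalgebraic:
  assumes "tp_match id X a N b N'" "b \<in> X"
  shows "a = b"
proof -
  obtain P f1 f2 where P: "emb f1 N P" "\<forall>x\<in>X. f1 x = f2 x" "f1 a = f2 b"
    using assms unfolding tp_match_def by auto
  have "f1 a = f1 b" using P assms(2) by simp
  then show ?thesis using embD(3)[OF P(1)] tp_matchD(3,5)[OF assms(1)] assms(2)
    by (meson inj_onD subsetD)
qed

text \<open>The definition of \<open>gS_na\<close> ranges over all realizations, also those in
  uncountable models; each is matched with \<open>a\<close> inside a countable model, where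
  \<open>tp_match_nonalgebraic\<close> applies.\<close>

lemma gtp_in_gS_na_iff:
  assumes "M \<in> Kc K" "N \<in> Kc K" "le M N" "a \<in> s_univ N"
  shows "gtp K le M a N \<in> gS_na K le M \<longleftrightarrow> a \<notin> s_univ M"
proof
  assume "gtp K le M a N \<in> gS_na K le M"
  moreover have "(a,N) \<in> gtp K le M a N"
    unfolding gtp_def using assms by (auto intro!: gtp_eq_refl simp: valid_tr_def)
  ultimately show "a \<notin> s_univ M" unfolding gS_na_def by fastforce
next
  assume a: "a \<notin> s_univ M"
  have "fst t \<notin> s_univ M" if t: "t \<in> gtp K le M a N" for t
  proof
    assume f: "fst t \<in> s_univ M"
    have eq: "gtp_eq K le M (a,N) t" using t by (simp add: gtp_def)
    then have v: "le M (snd t)" "fst t \<in> s_univ (snd t)" using gtp_eq_valid(2)[OF eq] by (auto simp: valid_tr_def)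
    obtain N' where N': "N' \<in> Kc K" "le M N'" "le N' (snd t)" "fst t \<in> s_univ N'"
      using Kc_below[OF v(1) assms(1) v(2)] by blast
    have "a = fst t" by (rule tp_match_nonalgebraic[OF gtp_eq_imp_tp_match[OF eq assms(1,2) N'] f])
    then show False using f a by simp
  qed
  then show "gtp K le M a N \<in> gS_na K le M"
    unfolding gS_na_def using gtp_in_gS assms by blast
qed

lemma restr_gtp:
  assumes "le M0 M" "le M N" "a \<in> s_univ N"
  shows "restr K le M0 (gtp K le M a N) = gtp K le M0 a N"
proof (intro set_eqI iffI)
  fix t assume "t \<in> restr K le M0 (gtp K le M a N)"
  then obtain u where "gtp_eq K le M (a,N) u" "gtp_eq K le M0 u t"
    unfolding restr_def gtp_def by blast
  then show "t \<in> gtp K le M0 a N"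
    using gtp_eq_mono[OF _ assms(1)] gtp_eq_trans unfolding gtp_def by blast
next
  fix t assume "t \<in> gtp K le M0 a N"
  moreover have "(a,N) \<in> gtp K le M a N"
    unfolding gtp_def using assms by (auto intro!: gtp_eq_refl simp: valid_tr_def)
  ultimately show "t \<in> restr K le M0 (gtp K le M a N)" unfolding restr_def gtp_def by blast
qed

text \<open>\<open>tp_img\<close> collects the results of all realizations and all extensions of
  \<open>f\<close>. Any two choices give the same type over \<open>N2\<close>, so a single embedding
  \<open>g\<close> computes it.\<close>

lemma tp_img_gtp:
  assumes "N1 \<in> Kc K" "N \<in> Kc K" "N' \<in> Kc K" "le N1 N" "a \<in> s_univ N"
    and iso: "is_iso f N1 N2" and g: "emb g N N'" "\<And>x. x \<in> s_univ N1 \<Longrightarrow> g x = f x"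
  shows "tp_img K le f N1 N2 (gtp K le N1 a N) = gtp K le N2 (g a) N'"
proof (intro set_eqI iffI)
  have N2: "N2 \<in> Kc K" using iso_Kc[OF assms(1) iso] .
  have N2f: "s_univ N2 = f ` s_univ N1" and finj: "inj_on f (s_univ N1)"
    using iso by (auto simp: is_iso_def bij_betw_def)
  have sub: "s_univ N1 \<subseteq> s_univ N" using le_univ[OF assms(4)] .
  have leN2: "le N2 L'" if "emb k L L'" "le N1 L" "\<And>x. x \<in> s_univ N1 \<Longrightarrow> k x = f x" for k L L'
  proof -
    have "img k N1 = img f N1" by (rule img_cong[OF wf[OF Kc_in[OF assms(1)]] that(3)])
    then have "img k N1 = N2" using is_iso_imp_img[OF iso] by simp
    then show ?thesis using le_trans[OF img_le[OF that(2) embD(3)[OF that(1)]] embD(4)[OF that(1)]] by simp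
  qed
  {
    fix t assume "t \<in> gtp K le N2 (g a) N'"
    moreover have "(a,N) \<in> gtp K le N1 a N"
      unfolding gtp_def using assms by (auto intro!: gtp_eq_refl simp: valid_tr_def)
    ultimately show "t \<in> tp_img K le f N1 N2 (gtp K le N1 a N)"
      unfolding tp_img_def gtp_def using g by fastforce
  }
  fix t assume "t \<in> tp_img K le f N1 N2 (gtp K le N1 a N)"
  then obtain u k L where u: "gtp_eq K le N1 (a,N) u" "emb k (snd u) L" "\<forall>x\<in>s_univ N1. k x = f x"
    "gtp_eq K le N2 (k (fst u), L) t" unfolding tp_img_def gtp_def by blast
  have v: "le N1 (snd u)" "fst u \<in> s_univ (snd u)" using gtp_eq_valid(2)[OF u(1)] by (auto simp: valid_tr_def)
  obtain N0 where N0: "N0 \<in> Kc K" "le N1 N0" "le N0 (snd u)" "fst u \<in> s_univ N0"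
    using Kc_below[OF v(1) assms(1) v(2)] by blast
  have e0: "emb k N0 L" by (rule emb_le1[OF N0(3) u(2)])
  define L0 where "L0 = img k N0"
  have L0: "L0 \<in> Kc K" "le L0 L" "emb k N0 L0"
    unfolding L0_def using Kc_img[OF N0(1)] embD(3,4)[OF e0] emb_img[OF Kc_in[OF N0(1)]] by auto
  have 1: "tp_match f (s_univ N1) (fst u) N0 (k (fst u)) L0"
    using u(3) by (intro tp_match_emb N0(1,4) L0 le_univ[OF N0(2)]) auto
  have 2: "tp_match f (s_univ N1) a N (g a) N'"
    by (intro tp_match_emb assms sub)
  \<comment> \<open>The two choices are compared through \<open>N1\<close>: back along the inverse
    of \<open>f\<close>, across the equality of types over \<open>N1\<close>, and forward along
    \<open>f\<close> again.\<close>
  have 3: "tp_match (inv_into (s_univ N1) f) (s_univ N2) (g a) N' a N"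
    by (rule tp_match_inv[OF 2]) (auto simp: N2f finj)
  have 4: "tp_match (inv_into (s_univ N1) f) (s_univ N2) (g a) N' (fst u) N0"
    by (rule tp_match_trans[OF 3 gtp_eq_imp_tp_match[OF u(1) assms(1,2) N0]]) (auto simp: N2f finj)
  have 5: "tp_match id (s_univ N2) (g a) N' (k (fst u)) L0"
    by (rule tp_match_trans[OF 4 1]) (auto simp: N2f finj)
  have "le N2 N'" "le N2 L0" using leN2[OF g(1) assms(4) g(2)] leN2[OF L0(3) N0(2)] u(3) by auto
  then have "gtp K le N2 (g a) N' = gtp K le N2 (k (fst u)) L0"
    using tp_match_imp_gtp_eq[OF 5] gtp_eqI by blast
  also have "\<dots> = gtp K le N2 (k (fst u)) L"
    by (rule gtp_le[OF \<open>le N2 L0\<close> L0(2) embD(6)[OF L0(3) N0(4)]])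
  finally show "t \<in> gtp K le N2 (g a) N'" using u(4) by (simp add: gtp_def)
qed

section \<open>Nonsplitting\<close>

text \<open>Stated for an element instead of a type: \<open>tp_match f\<close> says directly that
  \<open>f\<close> carries the type of \<open>a\<close> over \<open>N1\<close> to its type over
  \<open>N2\<close>, without forming an image type.\<close>

definition nonsplit where
  "nonsplit M N a N' \<longleftrightarrow> (\<forall>N1 N2 f. N1 \<in> Kc K \<and> N2 \<in> Kc K \<and> le M N1 \<and> le N1 N \<and> le M N2 \<and> le N2 N \<and>
     is_iso f N1 N2 \<and> (\<forall>x\<in>s_univ M. f x = x) \<longrightarrow> tp_match f (s_univ N1) a N' a N')"

text \<open>The image under \<open>f\<close> of the type over \<open>N1\<close> is realized by
  \<open>g a\<close> in a renamed copy of \<open>N'\<close>, where \<open>g\<close> extends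
  \<open>f\<close>. Composing with the match along \<open>g\<close> turns equality over
  \<open>N2\<close> into a match along \<open>f\<close>.\<close>

lemma splits_iff:
  assumes "N \<in> Kc K" "N' \<in> Kc K" "le N N'" "a \<in> s_univ N'"
  shows "splits K le M N (gtp K le N a N') \<longleftrightarrow> \<not> nonsplit M N a N'"
proof -
  have *: "tp_img K le f N1 N2 (restr K le N1 (gtp K le N a N')) = restr K le N2 (gtp K le N a N')
      \<longleftrightarrow> tp_match f (s_univ N1) a N' a N'"
    if N: "N1 \<in> Kc K" "N2 \<in> Kc K" "le N1 N" "le N2 N" "is_iso f N1 N2" for N1 N2 f
  proof -
    have N1': "le N1 N'" and N2': "le N2 N'" using le_trans[OF _ assms(3)] N by blast+
    have N2f: "s_univ N2 = f ` s_univ N1" and finj: "inj_on f (s_univ N1)"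
      using N(5) by (auto simp: is_iso_def bij_betw_def)
    have eN: "emb f N1 N2" by (rule emb_iso[OF Kc_in[OF N(1)] N(5)])
    obtain g where g: "\<And>x. x \<in> s_univ N1 \<Longrightarrow> g x = f x" "img g N' \<in> Kc K"
      "le (img f N1) (img g N')" "emb g N' (img g N')"
      using emb_extend[OF eN N(1) assms(2) N1'] by metis
    have le2: "le N2 (img g N')" using g(3) is_iso_imp_img[OF N(5)] by simp
    have gm: "tp_match f (s_univ N1) a N' (g a) (img g N')"
      using g by (intro tp_match_emb assms le_univ[OF N1']) auto
    have gm': "tp_match (inv_into (s_univ N1) f) (s_univ N2) (g a) (img g N') a N'"
      by (rule tp_match_inv[OF gm]) (auto simp: N2f finj)
    have "tp_img K le f N1 N2 (restr K le N1 (gtp K le N a N')) = restr K le N2 (gtp K le N a N') \<longleftrightarrow>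
       gtp K le N2 (g a) (img g N') = gtp K le N2 a N'"
      using restr_gtp[OF N(3) assms(3,4)] restr_gtp[OF N(4) assms(3,4)]
        tp_img_gtp[OF N(1) assms(2) g(2) N1' assms(4) N(5) g(4) g(1)] by simp
    also have "\<dots> \<longleftrightarrow> tp_match id (s_univ N2) (g a) (img g N') a N'"
      by (rule gtp_eq_iff_tp_match[OF N(2) g(2) assms(2) le2 N2' embD(6)[OF g(4) assms(4)] assms(4)])
    also have "\<dots> \<longleftrightarrow> tp_match f (s_univ N1) a N' a N'"
    proof
      assume "tp_match id (s_univ N2) (g a) (img g N') a N'"
      then show "tp_match f (s_univ N1) a N' a N'" by (rule tp_match_trans[OF gm]) (auto simp: N2f)
    next
      assume "tp_match f (s_univ N1) a N' a N'"
      then show "tp_match id (s_univ N2) (g a) (img g N') a N'"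
        by (rule tp_match_trans[OF gm']) (auto simp: N2f finj)
    qed
    finally show ?thesis .
  qed
  show ?thesis unfolding splits_def nonsplit_def by (simp add: * cong: conj_cong)
qed

lemma nonsplitD:
  assumes "nonsplit M N a N'" "N1 \<in> Kc K" "N2 \<in> Kc K" "le M N1" "le N1 N" "le M N2" "le N2 N"
    "is_iso f N1 N2" "\<And>x. x \<in> s_univ M \<Longrightarrow> f x = x"
  shows "tp_match f (s_univ N1) a N' a N'"
  using assms unfolding nonsplit_def by blast

text \<open>The match along \<open>f\<close> for \<open>a\<close> is conjugated by the match of
  \<open>a\<close> with \<open>b\<close>, restricted to \<open>N1\<close> at one end and to
  \<open>N2\<close> at the other.\<close>

lemma nonsplit_tp_match:
  assumes "nonsplit M N a L" "tp_match id (s_univ N) a L b L'"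
  shows "nonsplit M N b L'"
  unfolding nonsplit_def
proof (intro allI impI, elim conjE)
  fix N1 N2 f
  assume N: "N1 \<in> Kc K" "N2 \<in> Kc K" "le M N1" "le N1 N" "le M N2" "le N2 N"
    "is_iso f N1 N2" "\<forall>x\<in>s_univ M. f x = x"
  have N2: "s_univ N2 = f ` s_univ N1" using N(7) by (auto simp: is_iso_def bij_betw_def)
  have 1: "tp_match id (s_univ N1) b L' a L" using tp_match_sym[OF tp_match_mono[OF assms(2) le_univ[OF N(4)]]] .
  have 2: "tp_match f (s_univ N1) a L a L" using nonsplitD[OF assms(1) N(1-7)] N(8) by simp
  have 3: "tp_match f (s_univ N1) b L' a L" by (rule tp_match_trans[OF 1 2]) auto
  show "tp_match f (s_univ N1) b L' b L'"
    by (rule tp_match_trans[OF 3 tp_match_mono[OF assms(2) le_univ[OF N(6)]]]) (auto simp: N2)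
qed

lemma nonsplit_mono:
  assumes "nonsplit M N a L" "le M M'" "le N' N"
  shows "nonsplit M' N' a L"
  unfolding nonsplit_def
proof (intro allI impI, elim conjE)
  fix N1 N2 f
  assume N: "N1 \<in> Kc K" "N2 \<in> Kc K" "le M' N1" "le N1 N'" "le M' N2" "le N2 N'"
    "is_iso f N1 N2" "\<forall>x\<in>s_univ M'. f x = x"
  show "tp_match f (s_univ N1) a L a L"
    using N(8) le_univ[OF assms(2)]
    by (intro nonsplitD[OF assms(1) N(1,2) le_trans[OF assms(2) N(3)] le_trans[OF N(4) assms(3)]
      le_trans[OF assms(2) N(5)] le_trans[OF N(6) assms(3)] N(7)]) auto
qed

lemma img_inv_into:
  assumes "M \<in> K" "inj_on g A" "s_univ M \<subseteq> A"
  shows "img (inv_into A g) (img g M) = M"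
  unfolding img_img using assms by (intro img_id[OF wf]) (auto simp: subset_iff)

text \<open>A map \<open>f'\<close> between submodels of the image of \<open>N\<close> is pulled
  back along \<open>k\<close>, the inverse of \<open>g\<close>. Nonsplitting applies to the
  resulting map \<open>f\<close>, and the match is pushed forward by \<open>g\<close>.\<close>

lemma nonsplit_emb:
  assumes "nonsplit M N a L" "L \<in> Kc K" "L' \<in> Kc K" "emb g L L'" "le M N" "le N L" "a \<in> s_univ L"
  shows "nonsplit (img g M) (img g N) (g a) L'"
  unfolding nonsplit_def
proof (intro allI impI, elim conjE)
  fix N1' N2' f'
  assume N: "N1' \<in> Kc K" "N2' \<in> Kc K" "le (img g M) N1'" "le N1' (img g N)"
    "le (img g M) N2'" "le N2' (img g N)"
    and f': "is_iso f' N1' N2'" "\<forall>x\<in>s_univ (img g M). f' x = x"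
  have gi: "inj_on g (s_univ L)" using embD(3)[OF assms(4)] .
  define k where "k = inv_into (s_univ L) g"
  define N1 where "N1 = img k N1'"
  define N2 where "N2 = img k N2'"
  define f where "f = k \<circ> f' \<circ> g"
  have sub: "s_univ M \<subseteq> s_univ L" "s_univ N \<subseteq> s_univ L"
    using le_univ[OF assms(5)] le_univ[OF assms(6)] by auto
  have sub': "s_univ N1' \<subseteq> g ` s_univ L" "s_univ N2' \<subseteq> g ` s_univ L"
    using le_univ[OF N(4)] le_univ[OF N(6)] image_mono[OF sub(2), of g] by auto
  have ki: "inj_on k A" if "A \<subseteq> g ` s_univ L" for A
    unfolding k_def using inj_on_subset[OF inj_on_inv_into[OF subset_refl] that] .
  have kg: "k (g x) = x" if "x \<in> s_univ L" for x using that gi by (simp add: k_def)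
  have gk: "g (k y) = y" "k y \<in> s_univ L" if "y \<in> g ` s_univ L" for y
    using that by (auto simp: k_def f_inv_into_f inv_into_into)
  have imgs: "img k (img g M) = M" "img k (img g N) = N"
    unfolding k_def using img_inv_into[OF _ gi] sub le_in(1)[OF assms(5)] le_in(1)[OF assms(6)] by auto
  have gN1: "img g N1 = N1'" unfolding N1_def img_img
    using gk(1) sub'(1) by (intro img_id[OF wf[OF Kc_in[OF N(1)]]]) auto
  have f'u: "s_univ N2' = f' ` s_univ N1'" "inj_on f' (s_univ N1')"
    using f'(1) by (auto simp: is_iso_def bij_betw_def)
  have fN1: "img f N1 = N2" unfolding f_def N2_def
    using gN1 is_iso_imp_img[OF f'(1)] by (simp add: img_img[symmetric])
  have u1: "s_univ N1 = k ` s_univ N1'" by (simp add: N1_def)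
  have u2: "s_univ N2 = k ` s_univ N2'" by (simp add: N2_def)
  have fk: "f (k y) = k (f' y)" if "y \<in> s_univ N1'" for y
    using gk(1)[of y] that sub'(1) by (auto simp: f_def)
  have "inj_on f (s_univ N1)"
  proof (rule inj_onI)
    fix x y assume "x \<in> s_univ N1" "y \<in> s_univ N1" "f x = f y"
    then obtain x' y' where xy: "x = k x'" "y = k y'" "x' \<in> s_univ N1'" "y' \<in> s_univ N1'"
      "k (f' x') = k (f' y')" using fk by (auto simp: u1)
    then have "f' x' = f' y'" using inj_onD[OF ki[OF sub'(2)] xy(5)] f'u(1) by auto
    then show "x = y" using xy inj_onD[OF f'u(2)] by auto
  qed
  then have iso: "is_iso f N1 N2" using is_iso_img fN1 by metis
  have K1: "N1 \<in> Kc K" "N2 \<in> Kc K" unfolding N1_def N2_def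
    by (rule Kc_img[OF N(1) ki[OF sub'(1)]], rule Kc_img[OF N(2) ki[OF sub'(2)]])
  have kN: "inj_on k (s_univ (img g N))" using sub(2) by (intro ki) auto
  have les: "le M N1" "le N1 N" "le M N2" "le N2 N"
    using img_le[OF N(3) ki[OF sub'(1)]] img_le[OF N(4) kN] img_le[OF N(5) ki[OF sub'(2)]]
      img_le[OF N(6) kN] imgs by (simp_all add: N1_def N2_def)
  have 1: "tp_match f (s_univ N1) a L a L"
  proof (rule nonsplitD[OF assms(1) K1 les iso])
    fix x assume x: "x \<in> s_univ M"
    then have "f' (g x) = g x" using f'(2) by simp
    then show "f x = x" using kg x sub by (auto simp: f_def)
  qed
  have 2: "tp_match k (s_univ N1') (g a) L' a L"
  proof (rule tp_match_inv)
    show "tp_match g (s_univ N1) a L (g a) L'"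
      using gk(2) sub'(1) u1 by (intro tp_match_emb assms) auto
  qed (use gk sub'(1) u1 in auto)
  have 3: "tp_match (f \<circ> k) (s_univ N1') (g a) L' a L"
    by (rule tp_match_trans[OF 2 1]) (auto simp: u1)
  have 4: "tp_match g (s_univ N2) a L (g a) L'"
      using gk(2) sub'(2) u2 by (intro tp_match_emb assms) auto
  show "tp_match f' (s_univ N1') (g a) L' (g a) L'"
  proof (rule tp_match_trans[OF 3 4])
    fix y assume y: "y \<in> s_univ N1'"
    then have "f' y \<in> s_univ N2'" using f'u(1) by simp
    then show "(f \<circ> k) y \<in> s_univ N2 \<and> g ((f \<circ> k) y) = f' y"
      using fk[OF y] gk(1)[of "f' y"] sub'(2) u2 by auto
  qed
qed

section \<open>Universal extensions, weak uniqueness and weak extension\<close>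

lemma univ_overD:
  assumes "univ_over M0 M1"
  shows "M0 \<in> Kc K" "M1 \<in> Kc K" "le M0 M1"
  using assms unfolding universal_over_def by auto

lemma univ_over_emb:
  assumes "univ_over M0 M1" "N \<in> Kc K" "le M0 N"
  obtains f where "emb f N M1" "\<And>x. x \<in> s_univ M0 \<Longrightarrow> f x = x"
  using assms unfolding universal_over_def by blast

text \<open>An extension \<open>N\<close> of the smaller base is amalgamated with \<open>M0\<close>
  over \<open>M0'\<close>; the amalgam embeds into \<open>M1\<close> over \<open>M0\<close>, and
  this carries \<open>N\<close> along.\<close>

lemma univ_over_mono:
  assumes "univ_over M0 M1" "le M0' M0" "M0' \<in> Kc K" "le M1 M1'" "M1' \<in> Kc K"
  shows "univ_over M0' M1'"
  unfolding universal_over_def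
proof (intro conjI ballI impI assms)
  note U = univ_overD[OF assms(1)]
  show "le M0' M1'" using le_trans[OF le_trans[OF assms(2) U(3)] assms(4)] .
  fix N assume N: "N \<in> Kc K" "le M0' N"
  obtain P g where P: "P \<in> Kc K" "le M0 P" "emb g N P" "\<And>x. x \<in> s_univ M0' \<Longrightarrow> g x = x"
    using amalgamation_le[OF assms(3) U(1) N(1) assms(2) N(2)] by metis
  obtain f where f: "emb f P M1" "\<And>x. x \<in> s_univ M0 \<Longrightarrow> f x = x"
    using univ_over_emb[OF assms(1) P(1,2)] by metis
  have "emb (f \<circ> g) N M1'" by (rule emb_le2[OF emb_comp[OF P(3) f(1)] assms(4)])
  moreover have "\<forall>x\<in>s_univ M0'. (f \<circ> g) x = x"
    using P(4) f(2) le_univ[OF assms(2)] by auto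
  ultimately show "\<exists>f. emb f N M1' \<and> (\<forall>x\<in>s_univ M0'. f x = x)" by blast
qed

text \<open>Universality gives a map \<open>g\<close> folding \<open>N\<close> into \<open>M\<close>
  over \<open>M0\<close>. By nonsplitting, the types of \<open>a\<close> and \<open>b\<close> over
  \<open>N\<close> correspond under \<open>g\<close> to their types over the image, and these agree
  because the image lies inside \<open>M\<close>.\<close>

lemma nonsplit_unique:
  assumes "univ_over M0 M" "le M N" "N \<in> Kc K" "nonsplit M0 N a L" "nonsplit M0 N b L'"
    "tp_match id (s_univ M) a L b L'"
  shows "tp_match id (s_univ N) a L b L'"
proof -
  note U = univ_overD[OF assms(1)]
  have M0N: "le M0 N" by (rule le_trans[OF U(3) assms(2)])
  obtain g where g: "emb g N M" "\<And>x. x \<in> s_univ M0 \<Longrightarrow> g x = x"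
    using univ_over_emb[OF assms(1,3) M0N] by metis
  have gi: "inj_on g (s_univ N)" using embD(3)[OF g(1)] .
  have "img g M0 = M0" by (rule img_id[OF wf[OF Kc_in[OF U(1)]] g(2)])
  then have M0g: "le M0 (img g N)" using img_le[OF M0N gi] by simp
  have gN: "le (img g N) M" using embD(4)[OF g(1)] .
  note nonsplitD' = nonsplitD[OF _ assms(3) Kc_img[OF assms(3) gi] M0N le_refl[OF Kc_in[OF assms(3)]]
     M0g le_trans[OF gN assms(2)] is_iso_img[OF gi] g(2)]
  have 1: "tp_match g (s_univ N) a L a L" by (rule nonsplitD'[OF assms(4)])
  have 2: "tp_match g (s_univ N) b L' b L'" by (rule nonsplitD'[OF assms(5)])
  have 3: "tp_match (inv_into (s_univ N) g) (g ` s_univ N) b L' b L'"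
    by (rule tp_match_inv[OF 2]) (auto simp: gi)
  have 4: "tp_match id (g ` s_univ N) a L b L'" using tp_match_mono[OF assms(6) le_univ[OF gN]] by simp
  have 5: "tp_match g (s_univ N) a L b L'" by (rule tp_match_trans[OF 1 4]) auto
  show ?thesis by (rule tp_match_trans[OF 5 3]) (auto simp: gi)
qed

text \<open>The map \<open>g\<close> folds \<open>N\<close> into \<open>M\<close> over
  \<open>M0\<close>, and an extension \<open>k\<close> of its inverse to \<open>L\<close> unfolds
  it; the new realization is \<open>k a\<close>. Nonsplitting under \<open>g\<close> restricted to
  \<open>M\<close> shows that the type over \<open>M\<close> is unchanged.\<close>

lemma nonsplit_extension:
  assumes "univ_over M0 M" "le M N" "N \<in> Kc K" "nonsplit M0 M a L" "L \<in> Kc K" "le M L" "a \<in> s_univ L"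
  obtains b L' where "L' \<in> Kc K" "le N L'" "b \<in> s_univ L'" "tp_match id (s_univ M) a L b L'"
    "nonsplit M0 N b L'" "b \<in> s_univ N \<Longrightarrow> a \<in> s_univ M"
proof -
  note U = univ_overD[OF assms(1)]
  have M0N: "le M0 N" by (rule le_trans[OF U(3) assms(2)])
  obtain g where g: "emb g N M" "\<And>x. x \<in> s_univ M0 \<Longrightarrow> g x = x"
    using univ_over_emb[OF assms(1,3) M0N] by metis
  have gi: "inj_on g (s_univ N)" using embD(3)[OF g(1)] .
  have gM0: "img g M0 = M0" by (rule img_id[OF wf[OF Kc_in[OF U(1)]] g(2)])
  then have M0g: "le M0 (img g N)" using img_le[OF M0N gi] by simp
  have gN: "le (img g N) M" using embD(4)[OF g(1)] .
  obtain k where k: "inj_on k (s_univ L)" "\<And>x. x \<in> s_univ N \<Longrightarrow> k (g x) = x"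
    "img k L \<in> Kc K" "le N (img k L)" "emb k L (img k L)" "img k (img g N) = N"
    using emb_extend_inverse[OF g(1) assms(6,5)] by metis
  have kM0: "img k M0 = M0"
  proof (rule img_id[OF wf[OF Kc_in[OF U(1)]]])
    fix x assume x: "x \<in> s_univ M0"
    then have "x \<in> s_univ N" using le_univ[OF M0N] by blast
    then show "k x = x" using k(2)[of x] g(2)[OF x] by simp
  qed
  have gMM: "le (img g M) M"
    by (rule le_trans[OF img_le[OF assms(2) gi] gN])
  have giM: "inj_on g (s_univ M)" by (rule inj_on_subset[OF gi le_univ[OF assms(2)]])
  have M0gM: "le M0 (img g M)" using img_le[OF U(3) giM] gM0 by simp
  have 1: "tp_match g (s_univ M) a L a L"
    by (rule nonsplitD[OF assms(4) U(2) Kc_img[OF U(2) giM] U(3) le_refl[OF Kc_in[OF U(2)]] M0gM gMM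
      is_iso_img[OF giM] g(2)])
  have 2: "tp_match k (g ` s_univ M) a L (k a) (img k L)"
    using le_univ[OF gMM] le_univ[OF assms(6)] by (intro tp_match_emb assms k) auto
  have 3: "tp_match id (s_univ M) a L (k a) (img k L)"
    by (rule tp_match_trans[OF 1 2]) (use k(2) le_univ[OF assms(2)] in auto)
  have "nonsplit M0 (img g N) a L" by (rule nonsplit_mono[OF assms(4) le_refl[OF Kc_in[OF U(1)]] gN])
  from nonsplit_emb[OF this assms(5) k(3,5) M0g le_trans[OF gN assms(6)] assms(7)]
  have 4: "nonsplit M0 N (k a) (img k L)" using kM0 k(6) by simp
  \<comment> \<open>If \<open>k a\<close> lies in \<open>N\<close>, then \<open>g (k a)\<close> and
    \<open>a\<close> have the same value under the injective \<open>k\<close>, so \<open>a\<close>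
    lies in the image of \<open>g\<close>, inside \<open>M\<close>. Hence nonalgebraic types get
    nonalgebraic extensions.\<close>
  have 5: "a \<in> s_univ M" if "k a \<in> s_univ N"
  proof -
    have "g (k a) \<in> s_univ L" using embD(6)[OF g(1) that] le_univ[OF assms(6)] by blast
    moreover have "k (g (k a)) = k a" using k(2)[OF that] .
    ultimately have "g (k a) = a" using inj_onD[OF k(1)] assms(7) by blast
    then show ?thesis using embD(6)[OF g(1) that] by simp
  qed
  show ?thesis by (rule that[OF k(3,4) embD(6)[OF k(5) assms(7)] 3 4 5])
qed

section \<open>Universal and limit models\<close>

lemma le_rel_subset: "le M N \<Longrightarrow> s_rel M R \<subseteq> s_rel N R"
  using le_substruc[of M N] by (auto simp: substruc_def)

lemma UN_le_cofinal:
  assumes "\<And>M. M \<in> C \<Longrightarrow> \<exists>M'\<in>D. le M M'"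
  shows "(\<Union>M\<in>C. s_univ M) \<subseteq> (\<Union>M\<in>D. s_univ M)" "(\<Union>M\<in>C. s_rel M R) \<subseteq> (\<Union>M\<in>D. s_rel M R)"
proof -
  have "s_univ M \<subseteq> (\<Union>M\<in>D. s_univ M)" "s_rel M R \<subseteq> (\<Union>M\<in>D. s_rel M R)" if M: "M \<in> C" for M
  proof -
    obtain M' where "M' \<in> D" "le M M'" using assms[OF M] by blast
    then show "s_univ M \<subseteq> (\<Union>M\<in>D. s_univ M)" "s_rel M R \<subseteq> (\<Union>M\<in>D. s_rel M R)"
      using le_univ[of M M'] le_rel_subset[of M M'] by blast+
  qed
  then show "(\<Union>M\<in>C. s_univ M) \<subseteq> (\<Union>M\<in>D. s_univ M)" "(\<Union>M\<in>C. s_rel M R) \<subseteq> (\<Union>M\<in>D. s_rel M R)"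
    by blast+
qed

lemma UnionS_eq_cofinal:
  assumes "\<And>M. M \<in> C \<Longrightarrow> \<exists>M'\<in>D. le M M'" "\<And>M. M \<in> D \<Longrightarrow> \<exists>M'\<in>C. le M M'"
  shows "UnionS C = UnionS D"
proof (rule struc_eqI)
  show "s_univ (UnionS C) = s_univ (UnionS D)"
    unfolding univ_UnionS by (rule equalityI) (rule UN_le_cofinal, erule assms)+
  have "(\<Union>M\<in>C. s_rel M R) = (\<Union>M\<in>D. s_rel M R)" for R
    by (rule equalityI) (rule UN_le_cofinal, erule assms)+
  then show "s_rel (UnionS C) = s_rel (UnionS D)" by (simp add: UnionS_def)
qed

lemma chain_finite_subset:
  fixes Q :: "nat \<Rightarrow> ('a,'r) struc"
  assumes "\<And>n. le (Q n) (Q (Suc n))" "finite F" "F \<subseteq> s_univ (UnionS (range Q))"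
  obtains n where "F \<subseteq> s_univ (Q n)" "m \<le> n"
proof -
  have "\<exists>n\<ge>m. F \<subseteq> s_univ (Q n)" using assms(2,3)
  proof (induction F rule: finite_induct)
    case (insert x F)
    then obtain n where n: "n \<ge> m" "F \<subseteq> s_univ (Q n)" by auto
    obtain k where k: "x \<in> s_univ (Q k)" using insert by auto
    have "s_univ (Q n) \<subseteq> s_univ (Q (max n k))" "s_univ (Q k) \<subseteq> s_univ (Q (max n k))"
      using le_univ chain_le[of Q, OF assms(1)] by (meson max.cobounded1 max.cobounded2)+
    then show ?case using n k by (intro exI[of _ "max n k"]) auto
  qed auto
  then show ?thesis using that by blast
qed

lemma emb_UnionS:
  fixes Q :: "nat \<Rightarrow> ('a,'r) struc"
  assumes Q: "\<And>n. le (Q n) (Q (Suc n))" and g: "\<And>n. emb (g n) (Q n) P"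
    and ext: "\<And>n x. x \<in> s_univ (Q n) \<Longrightarrow> g (Suc n) x = g n x"
  obtains h where "emb h (UnionS (range Q)) P" "\<And>n x. x \<in> s_univ (Q n) \<Longrightarrow> h x = g n x"
proof -
  \<comment> \<open>By \<open>ext\<close>, every index \<open>n\<close> with \<open>x\<close> in
    \<open>Q n\<close> gives the same value; the least one is a convenient choice.\<close>
  define h where "h x = g (LEAST n. x \<in> s_univ (Q n)) x" for x
  have mono: "s_univ (Q m) \<subseteq> s_univ (Q n)" if "m \<le> n" for m n
    using le_univ[OF chain_le[of Q, OF Q that]] .
  have ext': "g n x = g m x" if "m \<le> n" "x \<in> s_univ (Q m)" for m n x
    using that(1)
  proof (induction n rule: dec_induct)
    case (step n)
    then show ?case using ext[of x n] mono[of m n] that(2) by auto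
  qed simp
  have h: "h x = g n x" if "x \<in> s_univ (Q n)" for n x
    unfolding h_def using ext'[OF Least_le[of "\<lambda>n. x \<in> s_univ (Q n)", OF that] LeastI[of "\<lambda>n. x \<in> s_univ (Q n)", OF that]] by simp
  have hi: "inj_on h (s_univ (UnionS (range Q)))"
  proof (rule inj_onI)
    fix x y assume xy: "x \<in> s_univ (UnionS (range Q))" "y \<in> s_univ (UnionS (range Q))" "h x = h y"
    then obtain n where "{x,y} \<subseteq> s_univ (Q n)" using chain_finite_subset[where Q = Q and F = "{x,y}" and m = 0, OF Q] by auto
    then show "x = y" using h xy(3) inj_onD[OF embD(3)[OF g[of n]]] by auto
  qed
  have "le (img h (Q n)) (img h (Q (Suc n)))" for n
    using inj_on_subset[OF hi] by (intro img_le[OF Q]) auto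
  moreover have "le (img h (Q n)) P" for n
  proof -
    have "img h (Q n) = img (g n) (Q n)" by (rule img_cong[OF wf[OF le_in(1)[OF Q]] h])
    then show ?thesis using embD(4)[OF g[of n]] by simp
  qed
  ultimately have "le (UnionS (range (\<lambda>n. img h (Q n)))) P"
    by (intro omega_chain(3)[of "\<lambda>n. img h (Q n)"])
  then have "le (img h (UnionS (range Q))) P" by (simp add: img_UnionS image_image)
  then have "emb h (UnionS (range Q)) P"
    unfolding kemb_def using hi omega_chain(1)[of Q, OF Q] le_in(2) by blast
  then show ?thesis using that h by blast
qed

section \<open>Realizing types and the existence of universal extensions\<close>

lemma realize_one:
  assumes "M \<in> Kc K" "N \<in> Kc K" "le M N" "p \<in> gS K le M"
  obtains N' b where "N' \<in> Kc K" "le N N'" "b \<in> s_univ N'" "gtp K le M b N' = p"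
proof -
  obtain a L where L: "L \<in> Kc K" "le M L" "a \<in> s_univ L" "p = gtp K le M a L"
    using gS_Kc[OF assms(4,1)] by blast
  obtain N' g where N': "N' \<in> Kc K" "le N N'" "emb g L N'" "\<And>x. x \<in> s_univ M \<Longrightarrow> g x = x"
    using amalgamation_le[OF assms(1,2) L(1) assms(3) L(2)] by metis
  have ga: "g a \<in> s_univ N'" using embD(6)[OF N'(3) L(3)] .
  have "tp_match id (s_univ M) a L (g a) N'"
    using N' L le_univ[OF L(2)] by (intro tp_match_emb) auto
  then have "gtp K le M (g a) N' = p"
    using gtp_eq_iff_tp_match[OF assms(1) L(1) N'(1) L(2) le_trans[OF assms(3) N'(2)] L(3) ga] L(4) by simp
  then show ?thesis using that N' ga by blast
qed

text \<open>Stability allows the types over the fixed model \<open>M\<close> to be enumerated, and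
  each step of an \<omega>-chain realizes one of them.\<close>

lemma realize_all:
  assumes "stable_c K le" "M \<in> Kc K"
  obtains N where "N \<in> Kc K" "le M N" "\<And>p. p \<in> gS K le M \<Longrightarrow> \<exists>b\<in>s_univ N. gtp K le M b N = p"
proof -
  define p where "p = from_nat_into (gS K le M)"
  have "s_univ M \<noteq> {}" using assms(2) by (auto simp: Kc_def)
  then have ne: "gS K le M \<noteq> {}" using gtp_in_gS[OF le_refl[OF Kc_in[OF assms(2)]]] by blast
  have rp: "range p = gS K le M" unfolding p_def
    using assms ne by (intro range_from_nat_into) (auto simp: stable_c_def)
  have "\<exists>Q. \<forall>n. (Q n \<in> Kc K \<and> le M (Q n)) \<and>
      (le (Q n) (Q (Suc n)) \<and> (\<exists>b\<in>s_univ (Q (Suc n)). gtp K le M b (Q (Suc n)) = p n))"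
  proof (rule dependent_nat_choice)
    show "\<exists>x. x \<in> Kc K \<and> le M x" using assms(2) le_refl Kc_in by blast
    fix N and n :: nat assume N: "N \<in> Kc K \<and> le M N"
    have "p n \<in> gS K le M" using rp by auto
    then obtain N' b where "N' \<in> Kc K" "le N N'" "b \<in> s_univ N'" "gtp K le M b N' = p n"
      using realize_one[OF assms(2)] N by blast
    then show "\<exists>y. (y \<in> Kc K \<and> le M y) \<and> le N y \<and> (\<exists>b\<in>s_univ y. gtp K le M b y = p n)"
      using le_trans[of M N N'] N by blast
  qed
  then obtain Q where Q': "\<forall>n. (Q n \<in> Kc K \<and> le M (Q n)) \<and>
      (le (Q n) (Q (Suc n)) \<and> (\<exists>b\<in>s_univ (Q (Suc n)). gtp K le M b (Q (Suc n)) = p n))" ..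
  note Q = Q'[THEN spec, THEN conjunct1, THEN conjunct1] Q'[THEN spec, THEN conjunct1, THEN conjunct2]
    Q'[THEN spec, THEN conjunct2, THEN conjunct1] Q'[THEN spec, THEN conjunct2, THEN conjunct2]
  let ?N = "UnionS (range Q)"
  have "\<exists>b\<in>s_univ ?N. gtp K le M b ?N = q" if q: "q \<in> gS K le M" for q
  proof -
    obtain n where n: "q = p n" using q rp by blast
    obtain b where b: "b\<in>s_univ (Q (Suc n))" "gtp K le M b (Q (Suc n)) = p n" using Q(4) by blast
    have "gtp K le M b ?N = q"
      using gtp_le[OF Q(2) omega_chain(2)[of Q, OF Q(3)] b(1)] b(2) n by simp
    then show ?thesis using b(1) by auto
  qed
  then show ?thesis
    using that[of ?N] omega_chain_Kc[of Q, OF Q(3,1)] le_trans[OF Q(2) omega_chain(2)[of Q, OF Q(3)]] by blast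
qed

text \<open>The union of a chain whose successor steps realize all types is universal: a given extension \<open>N\<close>
  is absorbed element by element, by maps from the chain into larger and larger extensions of \<open>N\<close>
  whose limit is inverted at the end.\<close>

lemma universal_exists:
  assumes "stable_c K le" "M \<in> Kc K"
  obtains N where "univ_over M N"
proof -
  have "\<exists>Q. \<forall>n. (Q n \<in> Kc K \<and> (n = 0 \<longrightarrow> Q n = M)) \<and>
      (le (Q n) (Q (Suc n)) \<and> (\<forall>p\<in>gS K le (Q n). \<exists>b\<in>s_univ (Q (Suc n)). gtp K le (Q n) b (Q (Suc n)) = p))"
  proof (rule dependent_nat_choice)
    show "\<exists>x. x \<in> Kc K \<and> (0 = 0 \<longrightarrow> x = M)" using assms(2) by blast
    fix N and n :: nat assume "N \<in> Kc K \<and> (n = 0 \<longrightarrow> N = M)"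
    then obtain N' where "N' \<in> Kc K" "le N N'" "\<And>p. p \<in> gS K le N \<Longrightarrow> \<exists>b\<in>s_univ N'. gtp K le N b N' = p"
      using realize_all[OF assms(1)] by blast
    then show "\<exists>y. (y \<in> Kc K \<and> (Suc n = 0 \<longrightarrow> y = M)) \<and> le N y \<and> (\<forall>p\<in>gS K le N. \<exists>b\<in>s_univ y. gtp K le N b y = p)"
      by blast
  qed
  then obtain Q where Q': "\<forall>n. (Q n \<in> Kc K \<and> (n = 0 \<longrightarrow> Q n = M)) \<and>
      (le (Q n) (Q (Suc n)) \<and> (\<forall>p\<in>gS K le (Q n). \<exists>b\<in>s_univ (Q (Suc n)). gtp K le (Q n) b (Q (Suc n)) = p))" ..
  note Q = Q'[THEN spec, THEN conjunct1, THEN conjunct1]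
    Q'[THEN spec, THEN conjunct1, THEN conjunct2, THEN mp, OF refl]
    Q'[THEN spec, THEN conjunct2, THEN conjunct1] Q'[THEN spec, THEN conjunct2, THEN conjunct2, THEN bspec]
  let ?U = "UnionS (range Q)"
  have MU: "le M ?U" using omega_chain(2)[of Q 0, OF Q(3)] Q(2) by simp
  have UK: "?U \<in> Kc K" by (rule omega_chain_Kc[of Q, OF Q(3,1)])
  have "\<exists>f. emb f N ?U \<and> (\<forall>x\<in>s_univ M. f x = x)" if N: "N \<in> Kc K" "le M N" for N
  proof -
    define a where "a = from_nat_into (s_univ N)"
    have "s_univ N \<noteq> {}" using N(1) by (auto simp: Kc_def)
    then have ra: "range a = s_univ N" unfolding a_def
      using Kc_countable[OF N(1)] by (intro range_from_nat_into)
    \<comment> \<open>A state at stage \<open>n\<close> is an extension of \<open>N\<close> together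
      with an embedding of \<open>Q n\<close> into it. A transition enlarges the extension, prolongs
      the embedding to \<open>Q (Suc n)\<close> and puts \<open>a n\<close> into its range.\<close>
    define St where "St n X \<longleftrightarrow> fst X \<in> Kc K \<and> le N (fst X) \<and> emb (snd X) (Q n) (fst X) \<and>
      (n = 0 \<longrightarrow> (\<forall>x\<in>s_univ M. snd X x = x))" for n :: nat and X :: "('a,'r) struc \<times> ('a \<Rightarrow> 'a)"
    define Tr where "Tr n X Y \<longleftrightarrow> le (fst X) (fst Y) \<and> (\<forall>x\<in>s_univ (Q n). snd Y x = snd X x) \<and>
      a n \<in> snd Y ` s_univ (Q (Suc n))" for n :: nat and X Y :: "('a,'r) struc \<times> ('a \<Rightarrow> 'a)"
    have "\<exists>X. \<forall>n. St n (X n) \<and> Tr n (X n) (X (Suc n))"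
    proof (rule dependent_nat_choice)
      show "\<exists>x. St 0 x" unfolding St_def using N Q(2) emb_id[OF N(2)] le_refl[OF Kc_in[OF N(1)]]
        by (intro exI[of _ "(N, id)"]) auto
    next
      fix X and n :: nat assume X: "St n X"
      obtain P g where Pg: "X = (P,g)" by (cases X)
      have P: "P \<in> Kc K" "le N P" "emb g (Q n) P" using X by (auto simp: St_def Pg)
      \<comment> \<open>After renaming by \<open>k\<close>, the embedding \<open>g\<close> is an
        inclusion, and the type of \<open>k (a n)\<close> over \<open>Q n\<close> is realized by
        some \<open>b\<close> in \<open>Q (Suc n)\<close>. The map \<open>m\<close> returns the
        resulting amalgam to an extension of \<open>P\<close>, sending the image of \<open>b\<close>
        to \<open>a n\<close>.\<close>
      obtain k where k: "\<And>x. x \<in> s_univ (Q n) \<Longrightarrow> k (g x) = x" "img k P \<in> Kc K"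
        "le (Q n) (img k P)" "emb k P (img k P)"
        using emb_extend_inverse[OF P(3) le_refl[OF Kc_in[OF P(1)]] P(1)] by metis
      have an: "a n \<in> s_univ P" using ra le_univ[OF P(2)] by auto
      have kan: "k (a n) \<in> s_univ (img k P)" by (rule embD(6)[OF k(4) an])
      obtain b where b: "b \<in> s_univ (Q (Suc n))"
        "gtp K le (Q n) b (Q (Suc n)) = gtp K le (Q n) (k (a n)) (img k P)"
        using Q(4)[OF gtp_in_gS[OF k(3) kan]] by blast
      then have "tp_match id (s_univ (Q n)) b (Q (Suc n)) (k (a n)) (img k P)"
        using gtp_eq_iff_tp_match[OF Q(1) Q(1) k(2) Q(3) k(3) b(1) kan] by simp
      then obtain R f1 f2 where R: "R \<in> Kc K" "emb f1 (Q (Suc n)) R" "emb f2 (img k P) R"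
        "\<forall>x\<in>s_univ (Q n). f1 x = f2 x" "f1 b = f2 (k (a n))" unfolding tp_match_def by auto
      have e: "emb (f2 \<circ> k) P R" by (rule emb_comp[OF k(4) R(3)])
      obtain m where m: "\<And>x. x \<in> s_univ P \<Longrightarrow> m ((f2 \<circ> k) x) = x" "img m R \<in> Kc K"
        "le P (img m R)" "emb m R (img m R)"
        using emb_extend_inverse[OF e le_refl[OF Kc_in[OF R(1)]] R(1)] by metis
      have "emb (m \<circ> f1) (Q (Suc n)) (img m R)" by (rule emb_comp[OF R(2) m(4)])
      then have 1: "St (Suc n) (img m R, m \<circ> f1)"
        unfolding St_def using m(2) le_trans[OF P(2) m(3)] by auto
      have "(m \<circ> f1) x = g x" if x: "x \<in> s_univ (Q n)" for x
        using R(4) x m(1)[OF embD(6)[OF P(3) x]] k(1)[OF x] by simp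
      moreover have "a n = (m \<circ> f1) b" using m(1)[OF an] R(5) by simp
      ultimately have "Tr n X (img m R, m \<circ> f1)" unfolding Tr_def Pg using m(3) b(1) by auto
      then show "\<exists>y. St (Suc n) y \<and> Tr n X y" using 1 by blast
    qed
    then obtain X where "\<forall>n. St n (X n) \<and> Tr n (X n) (X (Suc n))" ..
    then have X: "\<And>n. St n (X n)" "\<And>n. Tr n (X n) (X (Suc n))" by simp_all
    define P where "P n = fst (X n)" for n
    define g where "g n = snd (X n)" for n
    have P: "\<And>n. P n \<in> Kc K" "\<And>n. le N (P n)" "\<And>n. emb (g n) (Q n) (P n)" "\<And>x. x \<in> s_univ M \<Longrightarrow> g 0 x = x"
      "\<And>n. le (P n) (P (Suc n))" "\<And>n x. x \<in> s_univ (Q n) \<Longrightarrow> g (Suc n) x = g n x"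
      "\<And>n. a n \<in> g (Suc n) ` s_univ (Q (Suc n))"
      using X unfolding St_def Tr_def P_def g_def by blast+
    let ?P = "UnionS (range P)"
    have PU: "le (P n) ?P" for n using omega_chain(2)[of P, OF P(5)] .
    obtain h where h: "emb h ?U ?P" "\<And>n x. x \<in> s_univ (Q n) \<Longrightarrow> h x = g n x"
      using emb_UnionS[of Q g ?P, OF Q(3) emb_le2[OF P(3) PU] P(6)] by blast
    have hi: "inj_on h (s_univ ?U)" using embD(3)[OF h(1)] .
    have "s_univ N \<subseteq> h ` s_univ ?U"
    proof
      fix x assume "x \<in> s_univ N"
      then obtain n where "x = a n" using ra by auto
      then obtain y where "y \<in> s_univ (Q (Suc n))" "x = g (Suc n) y" using P(7)[of n] by auto
      then show "x \<in> h ` s_univ ?U" using h(2) by (intro image_eqI[of _ _ y]) auto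
    qed
    then have "le N (img h ?U)"
      by (intro coherence[OF le_trans[OF P(2) PU] embD(4)[OF h(1)]]) auto
    moreover define k where "k = inv_into (s_univ ?U) h"
    have "emb k (img h ?U) (img k (img h ?U))"
      unfolding k_def by (rule emb_img[OF le_in(1)[OF embD(4)[OF h(1)]]]) (simp add: inj_on_inv_into)
    moreover have "img k (img h ?U) = ?U" unfolding k_def by (rule emb_img_inv[OF h(1)])
    ultimately have "emb k N ?U" using emb_le1 by metis
    moreover have "k x = x" if "x \<in> s_univ M" for x
    proof -
      have "h x = x" using h(2)[of x 0] P(4) Q(2) that by simp
      moreover have "x \<in> s_univ ?U" using le_univ[OF MU] that by blast
      ultimately show ?thesis unfolding k_def using inv_into_f_f[OF hi, of x] by simp
    qed
    ultimately show ?thesis by blast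
  qed
  then have "univ_over M ?U" unfolding universal_over_def using assms(2) UK MU by blast
  then show ?thesis by (rule that)
qed

section \<open>Limit models as unions of \<omega>-chains with universal steps\<close>

lemma univ_chain_le: "(\<And>n. univ_over (Q n) (Q (Suc n))) \<Longrightarrow> le (Q n) (Q (Suc n))"
  using univ_overD(3) by blast

text \<open>Countable limit ordinals have cofinality \<open>\<omega>\<close>, and passing to a cofinal subsequence keeps the
  successor steps universal.\<close>

lemma limit_over_omega:
  "lim_over M0 M1 \<longleftrightarrow> (\<exists>Q. Q 0 = M0 \<and> (\<forall>n. univ_over (Q n) (Q (Suc n))) \<and> M1 = UnionS (range Q))"
proof
  assume "lim_over M0 M1"
  then obtain r N i0 where r: "wo_limit r" "wo_min r i0" "N i0 = M0" "incr_chain K le r N"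
    "\<And>i j. wo_succ r i j \<Longrightarrow> univ_over (N i) (N j)" "M1 = UnionS (N ` Field r)"
    unfolding limit_over_def by blast
  have W: "Well_order r" using r(1) by (simp add: wo_limit_def)
  have i0: "i0 \<in> Field r" using r(2) by (simp add: wo_min_def)
  have leN: "le (N i) (N j)" if "(i,j) \<in> r" for i j using that r(4) unfolding incr_chain_def by blast
  have NK: "N i \<in> Kc K" if "i \<in> Field r" for i using that r(4) unfolding incr_chain_def by blast
  obtain c where c: "c 0 = i0" "\<And>n. (c n, c (Suc n)) \<in> r" "\<And>n. c n \<noteq> c (Suc n)"
    "\<And>n. c n \<in> Field r" "\<And>i. i \<in> Field r \<Longrightarrow> \<exists>n. (i, c n) \<in> r"
    using wo_limit_cofinal[OF r(1) i0] by metis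
  have "univ_over (N (c n)) (N (c (Suc n)))" for n
  proof -
    \<comment> \<open>The immediate successor of \<open>c n\<close> is at most
      \<open>c (Suc n)\<close>, and universality survives enlarging the upper model.\<close>
    obtain s where s: "wo_succ r (c n) s" "(s, c (Suc n)) \<in> r"
      using wo_succ_exists[OF W c(2,3)] by blast
    show ?thesis
      by (rule univ_over_mono[OF r(5)[OF s(1)] le_refl[OF Kc_in[OF NK[OF c(4)]]] NK[OF c(4)] leN[OF s(2)] NK[OF c(4)]])
  qed
  moreover have "UnionS (N ` Field r) = UnionS (range (\<lambda>n. N (c n)))"
  proof (rule UnionS_eq_cofinal)
    fix M assume "M \<in> N ` Field r"
    then obtain i where i: "i \<in> Field r" "M = N i" by blast
    obtain n where "(i, c n) \<in> r" using c(5)[OF i(1)] by blast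
    then show "\<exists>M'\<in>range (\<lambda>n. N (c n)). le M M'" using leN i(2) by blast
  next
    fix M assume "M \<in> range (\<lambda>n. N (c n))"
    then obtain n where n: "M = N (c n)" by blast
    show "\<exists>M'\<in>N ` Field r. le M M'"
      using le_refl[OF Kc_in[OF NK[OF c(4)[of n]]]] c(4) n by blast
  qed
  ultimately show "\<exists>Q. Q 0 = M0 \<and> (\<forall>n. univ_over (Q n) (Q (Suc n))) \<and> M1 = UnionS (range Q)"
    using r(3,6) c(1) by (intro exI[of _ "\<lambda>n. N (c n)"]) auto
next
  assume "\<exists>Q. Q 0 = M0 \<and> (\<forall>n. univ_over (Q n) (Q (Suc n))) \<and> M1 = UnionS (range Q)"
  then obtain Q where Q: "Q 0 = M0" "\<And>n. univ_over (Q n) (Q (Suc n))" "M1 = UnionS (range Q)" by blast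
  have QK: "Q n \<in> Kc K" for n using univ_overD(1)[OF Q(2)] .
  have leQ: "le (Q n) (Q (Suc n))" for n using univ_overD(3)[OF Q(2)] .
  have "M1 \<in> Kc K" using omega_chain_Kc[of Q, OF leQ QK] Q(3) by simp
  moreover have "incr_chain K le natLeq Q"
    unfolding incr_chain_def using QK chain_le[of Q, OF leQ] by (auto simp: natLeq_def)
  moreover have "cont_chain natLeq Q" unfolding cont_chain_def using natLeq_no_wo_limpt by blast
  ultimately show "lim_over M0 M1" unfolding limit_over_def
    using natLeq_wo_limit natLeq_wo_min Q QK[of 0] natLeq_wo_succ
    by (auto simp: Field_natLeq intro!: exI[of _ natLeq] exI[of _ Q] exI[of _ "0::nat"])
qed

lemma limit_overI:
  "(\<And>n. univ_over (Q n) (Q (Suc n))) \<Longrightarrow> lim_over (Q 0) (UnionS (range Q))"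
  unfolding limit_over_omega by blast

lemma limit_over_Kc: "lim_over M0 M1 \<Longrightarrow> M0 \<in> Kc K" "lim_over M0 M1 \<Longrightarrow> M1 \<in> Kc K"
  by (simp_all add: limit_over_def)

lemma UnionS_shift:
  fixes Q :: "nat \<Rightarrow> ('a,'r) struc"
  assumes "\<And>n. le (Q n) (Q (Suc n))"
  shows "UnionS (range (\<lambda>n. Q (n + k))) = UnionS (range Q)"
proof (rule UnionS_eq_cofinal)
  fix M assume "M \<in> range Q"
  then obtain n where "M = Q n" by blast
  then show "\<exists>M'\<in>range (\<lambda>n. Q (n + k)). le M M'"
    using chain_le[of Q n "n + k", OF assms] by auto
next
  fix M assume "M \<in> range (\<lambda>n. Q (n + k))"
  then show "\<exists>M'\<in>range Q. le M M'" using le_refl[OF le_in(1)[OF assms]] by auto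
qed

lemma univ_chain_mono:
  assumes "\<And>n. univ_over (Q n) (Q (Suc n))" "m < n"
  shows "univ_over (Q m) (Q n)"
proof -
  have K: "Q n \<in> Kc K" for n using univ_overD(1)[OF assms(1)] .
  have "le (Q (Suc m)) (Q n)"
    using chain_le[of Q "Suc m" n, OF univ_chain_le[of Q, OF assms(1)]] assms(2) by simp
  then show ?thesis
    using univ_over_mono[OF assms(1)[of m] le_refl[OF Kc_in[OF K]] K _ K] by blast
qed

lemma univ_chain_limit:
  assumes "\<And>n. univ_over (Q n) (Q (Suc n))"
  shows "lim_over (Q k) (UnionS (range Q))"
  using limit_overI[of "\<lambda>n. Q (n + k)"] assms UnionS_shift[of Q k, OF univ_chain_le[of Q, OF assms]] by simp

text \<open>Any late enough member of a chain witnessing the limit serves as \<open>M\<close>, since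
  tails of the chain have the same union.\<close>

lemma limit_over_tail:
  assumes "lim_over M0 M1" "finite F" "F \<subseteq> s_univ M1"
  obtains M where "univ_over M0 M" "lim_over M M1" "F \<subseteq> s_univ M"
proof -
  obtain Q where Q: "Q 0 = M0" "\<And>n. univ_over (Q n) (Q (Suc n))" "M1 = UnionS (range Q)"
    using assms(1) unfolding limit_over_omega by blast
  \<comment> \<open>The bound \<open>1 \<le> n\<close> guarantees a universal step between
    \<open>M0\<close> and \<open>Q n\<close>.\<close>
  obtain n where n: "F \<subseteq> s_univ (Q n)" "1 \<le> n"
    using chain_finite_subset[where Q = Q and F = F and m = 1, OF univ_chain_le[of Q, OF Q(2)] assms(2)]
      assms(3) Q(3) by blast
  have "univ_over M0 (Q n)" using univ_chain_mono[of Q 0 n, OF Q(2)] n(2) Q(1) by simp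
  moreover have "lim_over (Q n) M1" using univ_chain_limit[of Q, OF Q(2)] Q(3) by simp
  ultimately show ?thesis using n(1) by (rule that)
qed

lemma limit_over_imp_univ:
  assumes "lim_over M0 M1"
  shows "univ_over M0 M1"
proof -
  obtain M where M: "univ_over M0 M" "lim_over M M1" using limit_over_tail[OF assms, of "{}"] by auto
  then obtain Q where Q: "Q 0 = M" "\<And>n. univ_over (Q n) (Q (Suc n))" "M1 = UnionS (range Q)"
    unfolding limit_over_omega by blast
  have "le M M1" using omega_chain(2)[of Q 0, OF univ_chain_le[of Q, OF Q(2)]] Q by simp
  then show ?thesis
    using univ_over_mono[OF M(1) le_refl[OF Kc_in] _ _ limit_over_Kc(2)[OF assms]] limit_over_Kc(1)[OF assms] by blast
qed

text \<open>The chain may start at \<open>M\<close> instead: its next member is universal over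
  \<open>M0\<close>, hence over the smaller \<open>M\<close>.\<close>

lemma limit_over_below:
  assumes "lim_over M0 M1" "M \<in> Kc K" "le M M0"
  shows "lim_over M M1"
proof -
  obtain M' where M': "univ_over M0 M'" "lim_over M' M1" using limit_over_tail[OF assms(1), of "{}"] by auto
  then obtain Q where Q: "Q 0 = M'" "\<And>n. univ_over (Q n) (Q (Suc n))" "M1 = UnionS (range Q)"
    unfolding limit_over_omega by blast
  define R where "R n = (case n of 0 \<Rightarrow> M | Suc k \<Rightarrow> Q k)" for n
  have MM': "univ_over M M'"
    by (rule univ_over_mono[OF M'(1) assms(3,2) le_refl[OF Kc_in]]) (rule univ_overD(2)[OF M'(1)])+
  have R: "univ_over (R n) (R (Suc n))" for n using MM' Q by (cases n) (auto simp: R_def)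
  have "UnionS (range R) = M1"
    using UnionS_shift[of R 1, OF univ_chain_le[of R, OF R]] Q(3) by (simp add: R_def)
  then show ?thesis using limit_overI[of R, OF R] by (simp add: R_def)
qed

lemma limit_exists:
  assumes "stable_c K le" "M \<in> Kc K"
  obtains N where "lim_over M N"
proof -
  have "\<exists>Q. \<forall>n. (Q n \<in> Kc K \<and> (n = 0 \<longrightarrow> Q n = M)) \<and> univ_over (Q n) (Q (Suc n))"
  proof (rule dependent_nat_choice)
    show "\<exists>x. x \<in> Kc K \<and> (0 = 0 \<longrightarrow> x = M)" using assms(2) by blast
    fix N and n :: nat assume "N \<in> Kc K \<and> (n = 0 \<longrightarrow> N = M)"
    then obtain N' where "univ_over N N'" using universal_exists[OF assms(1)] by blast
    then show "\<exists>y. (y \<in> Kc K \<and> (Suc n = 0 \<longrightarrow> y = M)) \<and> univ_over N y" using univ_overD(2) by blast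
  qed
  then obtain Q where Q: "\<forall>n. (Q n \<in> Kc K \<and> (n = 0 \<longrightarrow> Q n = M)) \<and> univ_over (Q n) (Q (Suc n))" ..
  then have "lim_over (Q 0) (UnionS (range Q))" by (intro limit_overI) simp
  then show ?thesis using that Q by simp
qed

lemma univ_over_img:
  assumes "univ_over M0 M1" "inj_on g (s_univ M1)"
  shows "univ_over (img g M0) (img g M1)"
  unfolding universal_over_def
proof (intro conjI ballI impI)
  note U = univ_overD[OF assms(1)]
  have gi: "inj_on g (s_univ M0)" by (rule inj_on_subset[OF assms(2) le_univ[OF U(3)]])
  show "img g M0 \<in> Kc K" "img g M1 \<in> Kc K" using Kc_img U assms(2) gi by auto
  show "le (img g M0) (img g M1)" by (rule img_le[OF U(3) assms(2)])
  fix N assume N: "N \<in> Kc K" "le (img g M0) N"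
  obtain k where k: "\<And>x. x \<in> s_univ M0 \<Longrightarrow> k (g x) = x" "img k N \<in> Kc K"
    "le M0 (img k N)" "emb k N (img k N)"
    using emb_extend_inverse[OF emb_img[OF Kc_in[OF U(1)] gi] N(2,1)] by metis
  obtain f where f: "emb f (img k N) M1" "\<And>x. x \<in> s_univ M0 \<Longrightarrow> f x = x"
    using univ_over_emb[OF assms(1) k(2,3)] by metis
  have "emb (g \<circ> (f \<circ> k)) N (img g M1)"
    by (rule emb_comp[OF emb_comp[OF k(4) f(1)] emb_img[OF Kc_in[OF U(2)] assms(2)]])
  moreover have "\<forall>x\<in>s_univ (img g M0). (g \<circ> (f \<circ> k)) x = x" using k(1) f(2) by auto
  ultimately show "\<exists>f. emb f N (img g M1) \<and> (\<forall>x\<in>s_univ (img g M0). f x = x)" by blast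
qed

lemma limit_over_img:
  assumes "lim_over M0 M1" "inj_on g (s_univ M1)"
  shows "lim_over (img g M0) (img g M1)"
proof -
  obtain Q where Q: "Q 0 = M0" "\<And>n. univ_over (Q n) (Q (Suc n))" "M1 = UnionS (range Q)"
    using assms(1) unfolding limit_over_omega by blast
  have "univ_over (img g (Q n)) (img g (Q (Suc n)))" for n
    by (rule univ_over_img[OF Q(2) inj_on_subset[OF assms(2)]]) (auto simp: Q(3))
  from limit_overI[of "\<lambda>n. img g (Q n)", OF this] show ?thesis
    using Q(1,3) by (simp add: img_UnionS image_image)
qed

text \<open>\<open>M\<close> has a limit extension \<open>M1\<close>, which is isomorphic to
  \<open>M\<close> by categoricity; the image of \<open>M\<close> under the isomorphism is the
  base.\<close>

lemma categorical_limit: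
  assumes "stable_c K le" "categorical_c K le" "M \<in> Kc K"
  obtains N where "lim_over N M"
proof -
  obtain M1 where M1: "lim_over M M1" using limit_exists[OF assms(1,3)] .
  obtain f where f: "is_iso f M1 M"
    using assms(2,3) limit_over_Kc(2)[OF M1] unfolding categorical_c_def by blast
  have "lim_over (img f M) (img f M1)" by (rule limit_over_img[OF M1 is_iso_inj[OF f]])
  then show ?thesis using that is_iso_imp_img[OF f] by simp
qed

end

section \<open>Nonforking\<close>

locale superstable_aec = countable_aec +
  assumes superstable: "superstable_c K le"
    and symmetry: "symmetry_c K le"
    and transitivity: "transitivity_c K le"
    and categorical: "categorical_c K le"
    and saturative: "saturative_c K le"
begin

lemma stable: "stable_c K le"
  using superstable by (simp add: superstable_c_def)

lemma nonsplit_local: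
  assumes Q: "\<And>n. univ_over (Q n) (Q (Suc n))" and L: "L \<in> Kc K" "le (UnionS (range Q)) L" "a \<in> s_univ L"
  obtains n where "nonsplit (Q n) (UnionS (range Q)) a L"
proof -
  have leQ: "le (Q n) (Q (Suc n))" for n using univ_overD(3)[OF Q] .
  have QK: "Q n \<in> Kc K" for n using univ_overD(1)[OF Q] .
  have "incr_chain K le natLeq Q"
    unfolding incr_chain_def using QK chain_le[of Q, OF leQ] by (auto simp: natLeq_def)
  moreover have "\<forall>i j. wo_succ natLeq i j \<longrightarrow> univ_over (Q i) (Q j)" using natLeq_wo_succ Q by simp
  ultimately have "\<forall>p\<in>gS K le (UnionS (Q ` Field natLeq)).
      \<exists>i\<in>Field natLeq. \<not> splits K le (Q i) (UnionS (Q ` Field natLeq)) p"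
    using superstable natLeq_wo_limit unfolding superstable_c_def by meson
  then obtain n where "\<not> splits K le (Q n) (UnionS (range Q)) (gtp K le (UnionS (range Q)) a L)"
    unfolding Field_natLeq using gtp_in_gS[OF L(2,3)] by blast
  then show ?thesis using that splits_iff[OF omega_chain_Kc[of Q, OF leQ QK] L] by blast
qed

lemma limit_over_above:
  assumes "lim_over M0 M1" "le M1 M2" "M2 \<in> Kc K"
  shows "lim_over M0 M2"
  using saturative[unfolded saturative_c_def, rule_format, of M0 M1 M2] assms limit_over_Kc[OF assms(1)]
    univ_overD(3)[OF limit_over_imp_univ[OF assms(1)]] by blast

lemma nonsplit_trans:
  assumes "lim_over A B" "lim_over B C" "le C L" "L \<in> Kc K" "a \<in> s_univ L" "nonsplit B C a L" "nonsplit A B a L"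
  shows "nonsplit A C a L"
proof -
  have BC: "le B C" using univ_overD(3)[OF limit_over_imp_univ[OF assms(2)]] .
  note k = limit_over_Kc(1)[OF assms(1)] limit_over_Kc[OF assms(2)]
  have BL: "le B L" using le_trans[OF BC assms(3)] .
  have "\<not> splits K le B C (gtp K le C a L)" using splits_iff[OF k(3) assms(4,3,5)] assms(6) by simp
  moreover have "\<not> splits K le A B (restr K le B (gtp K le C a L))"
    using restr_gtp[OF BC assms(3,5)] splits_iff[OF k(2) assms(4) BL assms(5)] assms(7) by simp
  ultimately have "\<not> splits K le A C (gtp K le C a L)"
    using transitivity[unfolded transitivity_c_def, rule_format, of A B C "gtp K le C a L"]
      k assms(1,2) gtp_in_gS[OF assms(3,5)] by blast
  then show ?thesis using splits_iff[OF k(3) assms(4,3,5)] by simp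
qed

definition nonfork where
  "nonfork M0 M1 a M3 \<longleftrightarrow> M0 \<in> Kc K \<and> M1 \<in> Kc K \<and> M3 \<in> Kc K \<and> le M0 M1 \<and> le M1 M3 \<and>
     a \<in> s_univ M3 \<and> a \<notin> s_univ M1 \<and> (\<exists>N. lim_over N M0 \<and> nonsplit N M1 a M3)"

lemma nonforkD:
  assumes "nonfork M0 M1 a M3"
  shows "M0 \<in> Kc K" "M1 \<in> Kc K" "M3 \<in> Kc K" "le M0 M1" "le M1 M3" "a \<in> s_univ M3" "a \<notin> s_univ M1"
  using assms by (simp_all add: nonfork_def)

lemma nonfork_witness:
  assumes "nonfork M0 M1 a M3"
  obtains N where "lim_over N M0" "nonsplit N M1 a M3"
  using assms unfolding nonfork_def by blast

lemma nonforkI: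
  assumes "M1 \<in> Kc K" "M3 \<in> Kc K" "le M0 M1" "le M1 M3" "a \<in> s_univ M3" "a \<notin> s_univ M1"
    "lim_over N M0" "nonsplit N M1 a M3"
  shows "nonfork M0 M1 a M3"
  using assms limit_over_Kc(2)[OF assms(7)] unfolding nonfork_def by blast

text \<open>\<open>M\<close> is limit over every member of a chain witnessing that it is a limit
  model, so the member supplied by superstability is an admissible base.\<close>

lemma limit_witness:
  assumes "M \<in> Kc K" "L \<in> Kc K" "le M L" "a \<in> s_univ L"
  obtains N where "lim_over N M" "nonsplit N M a L"
proof -
  obtain N where "lim_over N M" using categorical_limit[OF stable categorical assms(1)] .
  then obtain Q where Q: "Q 0 = N" "\<And>n. univ_over (Q n) (Q (Suc n))" "M = UnionS (range Q)"
    unfolding limit_over_omega by blast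
  obtain n where "nonsplit (Q n) (UnionS (range Q)) a L"
    using nonsplit_local[of Q, OF Q(2) assms(2) _ assms(4)] assms(3) Q(3) by blast
  then show ?thesis using that univ_chain_limit[of Q, OF Q(2)] Q(3) by blast
qed

text \<open>Nonforking depends only on the type over \<open>M1\<close>; both enlarging and shrinking
  the ambient model are instances.\<close>

lemma nonfork_tp_match:
  assumes "nonfork M0 M1 a L" "tp_match id (s_univ M1) a L b L'" "le M1 L'"
  shows "nonfork M0 M1 b L'"
proof -
  note D = nonforkD[OF assms(1)]
  obtain N where N: "lim_over N M0" "nonsplit N M1 a L" using nonfork_witness[OF assms(1)] .
  have "b \<notin> s_univ M1" using tp_match_nonalgebraic[OF assms(2)] D(7) by blast
  then show ?thesis
    using nonforkI[OF D(2) tp_matchD(2)[OF assms(2)] D(4) assms(3) tp_matchD(4)[OF assms(2)] _ N(1) nonsplit_tp_match[OF N(2) assms(2)]]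
    by blast
qed

lemma nonfork_mono:
  assumes "nonfork M0 M1 a L" "M0' \<in> Kc K" "M1' \<in> Kc K" "le M0 M0'" "le M0' M1'" "le M1' M1"
  shows "nonfork M0' M1' a L"
proof -
  note D = nonforkD[OF assms(1)]
  obtain N where N: "lim_over N M0" "nonsplit N M1 a L" using nonfork_witness[OF assms(1)] .
  show ?thesis
  proof (rule nonforkI[OF assms(3) D(3) assms(5) le_trans[OF assms(6) D(5)] D(6)])
    show "a \<notin> s_univ M1'" using D(7) le_univ[OF assms(6)] by blast
    show "lim_over N M0'" by (rule limit_over_above[OF N(1) assms(4,2)])
    show "nonsplit N M1' a L" by (rule nonsplit_mono[OF N(2) le_refl[OF Kc_in[OF limit_over_Kc(1)[OF N(1)]]] assms(6)])
  qed
qed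

lemma limit_over_univ_above:
  assumes "lim_over N M0" "le M0 M1" "M1 \<in> Kc K"
  shows "univ_over N M1"
  by (rule univ_over_mono[OF limit_over_imp_univ[OF assms(1)] le_refl[OF Kc_in[OF limit_over_Kc(1)[OF assms(1)]]]
      limit_over_Kc(1)[OF assms(1)] assms(2,3)])

text \<open>The witnesses for \<open>a\<close> and \<open>b\<close> may be incomparable. Over a limit extension \<open>M2\<close> of \<open>M1\<close>, transitivity
  moves the witness of \<open>a\<close> to the extension of the type of \<open>b\<close>, and weak uniqueness applies.\<close>

lemma nonfork_unique:
  assumes a: "nonfork M0 M1 a L" and b: "nonfork M0 M1 b L'" and ab: "tp_match id (s_univ M0) a L b L'"
  shows "tp_match id (s_univ M1) a L b L'"
proof -
  note A = nonforkD[OF a] and B = nonforkD[OF b]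
  obtain N where N: "lim_over N M0" "nonsplit N M1 a L" using nonfork_witness[OF a] .
  obtain N' where N': "lim_over N' M0" "nonsplit N' M1 b L'" using nonfork_witness[OF b] .
  have NM0: "le N M0" "le N' M0"
    using univ_overD(3)[OF limit_over_imp_univ[OF N(1)]] univ_overD(3)[OF limit_over_imp_univ[OF N'(1)]] by auto
  \<comment> \<open>Transitivity of nonsplitting needs a limit model over \<open>M0\<close>.
    \<open>M1\<close> need not be one, but \<open>M2\<close> is limit over \<open>M1\<close> and
    therefore over \<open>M0\<close>.\<close>
  obtain M2 where M2: "lim_over M1 M2" using limit_exists[OF stable A(2)] .
  have M12: "le M1 M2" using univ_overD(3)[OF limit_over_imp_univ[OF M2]] .
  have M02: "le M0 M2" by (rule le_trans[OF A(4) M12])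
  have M2K: "M2 \<in> Kc K" by (rule limit_over_Kc(2)[OF M2])
  obtain c Lc where c: "Lc \<in> Kc K" "le M2 Lc" "c \<in> s_univ Lc" "tp_match id (s_univ M1) a L c Lc" "nonsplit N M2 c Lc"
    using nonsplit_extension[OF limit_over_univ_above[OF N(1) A(4,2)] M12 M2K N(2) A(3,5,6)] by metis
  obtain d Ld where d: "Ld \<in> Kc K" "le M2 Ld" "d \<in> s_univ Ld" "tp_match id (s_univ M1) b L' d Ld" "nonsplit N' M2 d Ld"
    using nonsplit_extension[OF limit_over_univ_above[OF N'(1) A(4,2)] M12 M2K N'(2) B(3,5,6)] by metis
  have ca: "tp_match id (s_univ M0) c Lc a L" by (rule tp_match_sym[OF tp_match_mono[OF c(4) le_univ[OF A(4)]]])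
  have bd: "tp_match id (s_univ M0) b L' d Ld" by (rule tp_match_mono[OF d(4) le_univ[OF A(4)]])
  have ad: "tp_match id (s_univ M0) a L d Ld" by (rule tp_match_trans[OF ab bd]) auto
  have cd: "tp_match id (s_univ M0) c Lc d Ld" by (rule tp_match_trans[OF ca ad]) auto
  have "nonsplit M0 M2 d Ld" by (rule nonsplit_mono[OF d(5) NM0(2) le_refl[OF Kc_in[OF M2K]]])
  moreover have "nonsplit N M0 d Ld"
    by (rule nonsplit_tp_match[OF nonsplit_mono[OF N(2) le_refl[OF le_in(1)[OF NM0(1)]] A(4)] ad])
  ultimately have "nonsplit N M2 d Ld"
    using nonsplit_trans[OF N(1) limit_over_below[OF M2 A(1,4)] d(2,1,3)] by blast
  then have "tp_match id (s_univ M2) c Lc d Ld"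
    using nonsplit_unique[OF limit_over_imp_univ[OF N(1)] M02 M2K c(5) _ cd] by blast
  then have 1: "tp_match id (s_univ M1) c Lc d Ld" by (rule tp_match_mono[OF _ le_univ[OF M12]])
  have 2: "tp_match id (s_univ M1) a L d Ld" by (rule tp_match_trans[OF c(4) 1]) auto
  show ?thesis by (rule tp_match_trans[OF 2 tp_match_sym[OF d(4)]]) auto
qed

text \<open>The type over \<open>M1\<close> has an extension to \<open>M2\<close> not splitting over
  the witness \<open>N\<close> for \<open>M0\<close>. By saturativity \<open>M1\<close> is also
  limit over \<open>N\<close>, so this extension does not fork over \<open>M1\<close>, and
  uniqueness identifies it with the type of \<open>a\<close>.\<close>

lemma nonfork_trans:
  assumes "nonfork M1 M2 a L" "nonfork M0 M1 a L"
  shows "nonfork M0 M2 a L"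
proof -
  note A = nonforkD[OF assms(1)] and B = nonforkD[OF assms(2)]
  obtain N where N: "lim_over N M0" "nonsplit N M1 a L" using nonfork_witness[OF assms(2)] .
  obtain b L' where b: "L' \<in> Kc K" "le M2 L'" "b \<in> s_univ L'" "tp_match id (s_univ M1) a L b L'"
    "nonsplit N M2 b L'" "b \<in> s_univ M2 \<Longrightarrow> a \<in> s_univ M1"
    using nonsplit_extension[OF limit_over_univ_above[OF N(1) B(4,2)] A(4,2) N(2) B(3,5,6)] by metis
  have "b \<notin> s_univ M2" using b(6) B(7) by blast
  then have "nonfork M1 M2 b L'"
    using nonforkI[OF A(2) b(1) A(4) b(2,3) _ limit_over_above[OF N(1) B(4,2)] b(5)] by blast
  from nonfork_unique[OF this assms(1) tp_match_sym[OF b(4)]]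
  have "nonsplit N M2 a L" by (rule nonsplit_tp_match[OF b(5)])
  then show ?thesis by (rule nonforkI[OF A(2,3) le_trans[OF B(4) A(4)] A(5,6,7) N(1)])
qed

text \<open>Replaces the chain \<open>Q\<close> by a chain \<open>R\<close> with the same union and with universal successor steps,
  where \<open>Q n\<close> is a limit model over \<open>R n\<close>; saturativity keeps this invariant along the construction,
  and the finite sets \<open>F n\<close> exhaust the union.\<close>

lemma nonfork_local_omega:
  assumes Q: "\<And>n. le (Q n) (Q (Suc n))" "\<And>n. Q n \<in> Kc K"
    and L: "L \<in> Kc K" "le (UnionS (range Q)) L" "a \<in> s_univ L" "a \<notin> s_univ (UnionS (range Q))"
  obtains n where "nonfork (Q n) (UnionS (range Q)) a L"
proof -
  define e where "e k = from_nat_into (s_univ (Q k))" for k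
  have e: "range (e k) = s_univ (Q k)" for k
  proof -
    have "s_univ (Q k) \<noteq> {}" using Q(2)[of k] by (auto simp: Kc_def)
    then show ?thesis unfolding e_def using Kc_countable[OF Q(2)] by (rule range_from_nat_into)
  qed
  \<comment> \<open>Only finite sets can be absorbed by one member of a chain, hence finite pieces
    of the enumerations. At stage \<open>n\<close> only \<open>Q 0\<close> to \<open>Q n\<close>
    contribute, which keeps \<open>F n\<close> inside \<open>Q n\<close>.\<close>
  define F where "F n = (\<lambda>(k,m). e k m) ` ({..n} \<times> {..n})" for n
  have F: "finite (F n)" "F n \<subseteq> s_univ (Q n)" for n
  proof -
    show "finite (F n)" by (simp add: F_def)
    have "e k m \<in> s_univ (Q n)" if "k \<le> n" for k m
      using e[of k] le_univ[OF chain_le[of Q, OF Q(1) that]] by auto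
    then show "F n \<subseteq> s_univ (Q n)" by (auto simp: F_def)
  qed
  have "\<exists>R. \<forall>n. lim_over (R n) (Q n) \<and> (univ_over (R n) (R (Suc n)) \<and> F n \<subseteq> s_univ (R (Suc n)))"
  proof (rule dependent_nat_choice)
    show "\<exists>R. lim_over R (Q 0)" using categorical_limit[OF stable categorical Q(2)] by blast
    fix R n assume "lim_over R (Q n)"
    then have l: "lim_over R (Q (Suc n))" by (rule limit_over_above[OF _ Q])
    have "F n \<subseteq> s_univ (Q (Suc n))" using F(2)[of n] le_univ[OF Q(1)[of n]] by blast
    from limit_over_tail[OF l F(1) this]
    show "\<exists>y. lim_over y (Q (Suc n)) \<and> univ_over R y \<and> F n \<subseteq> s_univ y" by blast
  qed
  then obtain R where R': "\<forall>n. lim_over (R n) (Q n) \<and> (univ_over (R n) (R (Suc n)) \<and> F n \<subseteq> s_univ (R (Suc n)))" ..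
  then have R: "\<And>n. lim_over (R n) (Q n)" "\<And>n. univ_over (R n) (R (Suc n))" "\<And>n. F n \<subseteq> s_univ (R (Suc n))"
    by simp_all
  have leR: "le (R n) (R (Suc n))" for n using univ_overD(3)[OF R(2)] .
  have RQ: "le (R n) (Q n)" for n using univ_overD(3)[OF limit_over_imp_univ[OF R(1)]] .
  have QU: "le (Q n) (UnionS (range Q))" for n using omega_chain(2)[of Q, OF Q(1)] .
  have le: "le (UnionS (range R)) (UnionS (range Q))"
    using omega_chain(3)[of R, OF leR] le_trans[OF RQ QU] by blast
  have "s_univ (UnionS (range Q)) \<subseteq> s_univ (UnionS (range R))"
  proof
    fix x assume "x \<in> s_univ (UnionS (range Q))"
    then obtain k where "x \<in> s_univ (Q k)" by auto
    then obtain m where "x = e k m" using e[of k] by blast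
    then have "x \<in> F (max k m)" by (auto simp: F_def intro!: image_eqI[of _ _ "(k,m)"])
    then show "x \<in> s_univ (UnionS (range R))" using R(3)[of "max k m"] by auto
  qed
  then have eq: "UnionS (range R) = UnionS (range Q)"
    using substruc_univ_eq[OF le_substruc[OF le] _ wf[OF le_in(2)[OF le]]] le_univ[OF le] by blast
  \<comment> \<open>The base \<open>R n\<close> given by superstability is admissible for nonforking
    over \<open>Q n\<close>, since \<open>Q n\<close> is limit over \<open>R n\<close>.\<close>
  obtain n where n: "nonsplit (R n) (UnionS (range R)) a L"
    using nonsplit_local[of R, OF R(2) L(1) _ L(3)] L(2) eq by metis
  show ?thesis
    using nonforkI[OF omega_chain_Kc[of Q, OF Q] L(1) QU L(2,3,4) R(1)] n eq that by metis
qed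

text \<open>A cofinal sequence in \<open>r\<close> leaves the union unchanged and reduces the claim
  to \<omega>-chains.\<close>

lemma nonfork_local:
  assumes r: "wo_limit r" "incr_chain K le r N"
    and L: "L \<in> Kc K" "le (UnionS (N ` Field r)) L" "a \<in> s_univ L" "a \<notin> s_univ (UnionS (N ` Field r))"
  obtains i where "i \<in> Field r" "nonfork (N i) (UnionS (N ` Field r)) a L"
proof -
  have leN: "le (N i) (N j)" if "(i,j) \<in> r" for i j using that r(2) unfolding incr_chain_def by blast
  have NK: "N i \<in> Kc K" if "i \<in> Field r" for i using that r(2) unfolding incr_chain_def by blast
  obtain i0 where i0: "i0 \<in> Field r" using r(1) unfolding wo_limit_def by blast
  obtain c where c: "\<And>n. (c n, c (Suc n)) \<in> r" "\<And>n. c n \<in> Field r" "\<And>i. i \<in> Field r \<Longrightarrow> \<exists>n. (i, c n) \<in> r"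
    using wo_limit_cofinal[OF r(1) i0] by metis
  have eq: "UnionS (N ` Field r) = UnionS (range (\<lambda>n. N (c n)))"
  proof (rule UnionS_eq_cofinal)
    fix M assume "M \<in> N ` Field r"
    then obtain i where i: "i \<in> Field r" "M = N i" by blast
    obtain n where "(i, c n) \<in> r" using c(3)[OF i(1)] by blast
    then show "\<exists>M'\<in>range (\<lambda>n. N (c n)). le M M'" using leN i(2) by blast
  next
    fix M assume "M \<in> range (\<lambda>n. N (c n))"
    then obtain n where n: "M = N (c n)" by blast
    show "\<exists>M'\<in>N ` Field r. le M M'"
      using le_refl[OF Kc_in[OF NK[OF c(2)[of n]]]] c(2) n by blast
  qed
  obtain n where "nonfork (N (c n)) (UnionS (range (\<lambda>n. N (c n)))) a L"
    using nonfork_local_omega[of "\<lambda>n. N (c n)" L a, OF leN[OF c(1)] NK[OF c(2)] L(1)] L(2,3,4) unfolding eq by blast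
  then show ?thesis using that[OF c(2)] eq by simp
qed

lemma nonfork_img:
  assumes "nonfork M0 M1 a M3" "M3' \<in> Kc K" "is_iso f M3 M3'"
  shows "nonfork (img f M0) (img f M1) (f a) M3'"
proof -
  note D = nonforkD[OF assms(1)]
  obtain N where N: "lim_over N M0" "nonsplit N M1 a M3" using nonfork_witness[OF assms(1)] .
  have fi: "inj_on f (s_univ M3)" using is_iso_inj[OF assms(3)] .
  have e: "emb f M3 M3'" by (rule emb_iso[OF Kc_in[OF D(3)] assms(3)])
  have fi1: "inj_on f (s_univ M1)" by (rule inj_on_subset[OF fi le_univ[OF D(5)]])
  have fi0: "inj_on f (s_univ M0)" by (rule inj_on_subset[OF fi1 le_univ[OF D(4)]])
  have NM1: "le N M1" using le_trans[OF univ_overD(3)[OF limit_over_imp_univ[OF N(1)]] D(4)] .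
  show ?thesis
  proof (rule nonforkI)
    show "img f M1 \<in> Kc K" by (rule Kc_img[OF D(2) fi1])
    show "le (img f M0) (img f M1)" by (rule img_le[OF D(4) fi1])
    show "le (img f M1) M3'" using img_le[OF D(5) fi] is_iso_imp_img[OF assms(3)] by simp
    show "f a \<in> s_univ M3'" by (rule embD(6)[OF e D(6)])
    show "f a \<notin> s_univ (img f M1)"
      using D(6,7) inj_on_image_mem_iff[OF fi D(6) le_univ[OF D(5)]] by simp
    show "lim_over (img f N) (img f M0)" by (rule limit_over_img[OF N(1) fi0])
    show "nonsplit (img f N) (img f M1) (f a) M3'"
      by (rule nonsplit_emb[OF N(2) D(3) assms(2) e NM1 D(5,6)])
  qed fact
qed

text \<open>The base \<open>N0\<close> for the type over \<open>M\<close> also serves the extension,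
  because \<open>M\<close> is universal over \<open>N0\<close>.\<close>

lemma nonfork_extension:
  assumes "M \<in> Kc K" "N \<in> Kc K" "le M N" "L \<in> Kc K" "le M L" "a \<in> s_univ L" "a \<notin> s_univ M"
  obtains b L' where "nonfork M N b L'" "tp_match id (s_univ M) a L b L'"
proof -
  obtain N0 where N0: "lim_over N0 M" "nonsplit N0 M a L" using limit_witness[OF assms(1,4,5,6)] .
  obtain b L' where b: "L' \<in> Kc K" "le N L'" "b \<in> s_univ L'" "tp_match id (s_univ M) a L b L'"
    "nonsplit N0 N b L'" "b \<in> s_univ N \<Longrightarrow> a \<in> s_univ M"
    using nonsplit_extension[OF limit_over_imp_univ[OF N0(1)] assms(3,2) N0(2) assms(4,5,6)] by metis
  have "b \<notin> s_univ N" using b(6) assms(7) by blast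
  then show ?thesis
    using that[OF nonforkI[OF assms(2) b(1) assms(3) b(2,3) _ N0(1) b(5)] b(4)] by blast
qed

lemma nonfork_symmetry:
  assumes "M0 \<in> Kc K" "M1 \<in> Kc K" "M3 \<in> Kc K" "le M0 M1" "le M1 M3"
    and a1: "a1 \<in> s_univ M1" "a1 \<notin> s_univ M0" and a2: "nonfork M0 M1 a2 M3"
  obtains M2 M3' where "a2 \<in> s_univ M2" "le M0 M2" "le M2 M3'" "le M3 M3'" "nonfork M0 M2 a1 M3'"
proof -
  note D = nonforkD[OF a2]
  have M03: "le M0 M3" by (rule le_trans[OF assms(4,5)])
  have a1M3: "a1 \<in> s_univ M3" using a1(1) le_univ[OF assms(5)] by blast
  obtain N where N: "lim_over N M0" "nonsplit N M0 a1 M3" using limit_witness[OF assms(1,3) M03 a1M3] .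
  obtain N' where N': "lim_over N' M0" "nonsplit N' M1 a2 M3" using nonfork_witness[OF a2] .
  have N'M0: "le N' M0" using univ_overD(3)[OF limit_over_imp_univ[OF N'(1)]] .
  \<comment> \<open>Symmetry of the class wants \<open>a1\<close> in a model universal over
    \<open>M0\<close> over which the other type does not split. \<open>M1\<close> need not be
    universal over \<open>M0\<close>, so the type of \<open>a2\<close> is extended to
    \<open>U\<close>, where \<open>b\<close> realizes it.\<close>
  obtain U where U: "univ_over M1 U" using universal_exists[OF stable assms(2)] .
  note UD = univ_overD[OF U]
  obtain b L where b: "L \<in> Kc K" "le U L" "b \<in> s_univ L" "tp_match id (s_univ M1) a2 M3 b L"
    "nonsplit N' U b L" "b \<in> s_univ U \<Longrightarrow> a2 \<in> s_univ M1"
    using nonsplit_extension[OF limit_over_univ_above[OF N'(1) assms(4,2)] UD(3,2) N'(2) D(3,5,6)] by metis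
  have bU: "b \<notin> s_univ U" using b(6) D(7) by blast
  obtain P f1 f2 where P: "P \<in> Kc K" "emb f1 M3 P" "emb f2 L P" "\<forall>x\<in>s_univ M1. f1 x = f2 x" "f1 a2 = f2 b"
    using b(4) unfolding tp_match_def by auto
  \<comment> \<open>Renaming the amalgam to extend \<open>M3\<close> makes \<open>h\<close> fix
    \<open>M1\<close> and send \<open>b\<close> to \<open>a2\<close>. Thus the model is moved and
    not the element: the image \<open>M\<close> of \<open>U\<close> contains \<open>M1\<close>, and
    the type of \<open>a2\<close> itself over \<open>M\<close> does not split.\<close>
  obtain k where k: "\<And>x. x \<in> s_univ M3 \<Longrightarrow> k (f1 x) = x" "img k P \<in> Kc K"
    "le M3 (img k P)" "emb k P (img k P)"
    using emb_extend_inverse[OF P(2) le_refl[OF Kc_in[OF P(1)]] P(1)] by metis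
  define h where "h = k \<circ> f2"
  define P' where "P' = img k P"
  have P': "P' \<in> Kc K" "le M3 P'" using k unfolding P'_def by auto
  have h: "emb h L P'" unfolding h_def P'_def by (rule emb_comp[OF P(3) k(4)])
  have h1: "h x = x" if "x \<in> s_univ M1" for x
  proof -
    have "x \<in> s_univ M3" using that le_univ[OF assms(5)] by blast
    then have "k (f1 x) = x" by (rule k(1))
    then show ?thesis using P(4) that by (simp add: h_def)
  qed
  have h2: "h b = a2" using k(1)[OF D(6)] P(5) by (simp add: h_def)
  have hL: "inj_on h (s_univ L)" by (rule embD(3)[OF h])
  have hU: "inj_on h (s_univ U)" by (rule inj_on_subset[OF hL le_univ[OF b(2)]])
  define M where "M = img h U"
  have hM1: "img h M1 = M1" by (rule img_id[OF wf[OF Kc_in[OF assms(2)]] h1])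
  have hN': "img h N' = N'"
  proof (rule img_id[OF wf[OF le_in(1)[OF N'M0]]])
    fix x assume "x \<in> s_univ N'"
    then have "x \<in> s_univ M1" using le_univ[OF N'M0] le_univ[OF assms(4)] by blast
    then show "h x = x" by (rule h1)
  qed
  have M1M: "univ_over M1 M" using univ_over_img[OF U hU] hM1 by (simp add: M_def)
  note MD = univ_overD[OF M1M]
  have M0M: "univ_over M0 M"
    by (rule univ_over_mono[OF M1M assms(4,1) le_refl[OF Kc_in[OF MD(2)]] MD(2)])
  have MP: "le M P'" unfolding M_def by (rule le_trans[OF img_le[OF b(2) hL] embD(4)[OF h]])
  have M0P: "le M0 P'" by (rule le_trans[OF M03 P'(2)])
  have N'U: "le N' U" by (rule le_trans[OF le_trans[OF N'M0 assms(4)] UD(3)])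
  have "nonsplit N' M a2 P'"
    using nonsplit_emb[OF b(5,1) P'(1) h N'U b(2,3)] hN' h2 by (simp add: M_def)
  then have nonsplitM: "nonsplit M0 M a2 P'" by (rule nonsplit_mono[OF _ N'M0 le_refl[OF Kc_in[OF MD(2)]]])
  have a2M: "a2 \<notin> s_univ M"
    using inj_on_image_mem_iff[OF hL b(3) le_univ[OF b(2)]] bU h2 by (simp add: M_def)
  have a2P: "a2 \<in> s_univ P'" using D(6) le_univ[OF P'(2)] by blast
  have a1M: "a1 \<in> s_univ M" using a1(1) le_univ[OF MD(3)] by blast
  have a1P: "a1 \<in> s_univ P'" using a1M le_univ[OF MP] by blast
  have t1: "tp_match id (s_univ M0) a1 M3 a1 P'" by (rule tp_match_le[OF assms(3) P' a1M3 le_univ[OF M03]])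
  have t2: "tp_match id (s_univ M0) a1 P' a1 M"
    by (rule tp_match_sym[OF tp_match_le[OF MD(2) P'(1) MP a1M le_univ[OF univ_overD(3)[OF M0M]]]])
  have nP: "nonsplit N M0 a1 P'" by (rule nonsplit_tp_match[OF N(2) t1])
  have "nonsplit N M0 a1 M" by (rule nonsplit_tp_match[OF nP t2])
  then have s1: "\<not> splits K le N M0 (gtp K le M0 a1 M)"
    using splits_iff[OF assms(1) MD(2) univ_overD(3)[OF M0M] a1M] by simp
  have s2: "\<not> splits K le M0 M (gtp K le M a2 P')" using splits_iff[OF MD(2) P'(1) MP a2P] nonsplitM by simp
  have n1: "gtp K le M0 a1 M \<in> gS_na K le M0"
    using gtp_in_gS_na_iff[OF assms(1) MD(2) univ_overD(3)[OF M0M] a1M] a1(2) by simp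
  have n2: "gtp K le M a2 P' \<in> gS_na K le M" using gtp_in_gS_na_iff[OF MD(2) P'(1) MP a2P] a2M by simp
  have "\<exists>Mb N2. lim_over M0 Mb \<and> a2 \<in> s_univ Mb \<and> le P' N2 \<and> le Mb N2 \<and> \<not> splits K le N Mb (gtp K le Mb a1 N2)"
    by (rule symmetry[unfolded symmetry_c_def, rule_format, of M M0 N a1 P' a2])
      (use MD(2) assms(1) limit_over_Kc(1)[OF N(1)] M0M N(1) a1M a1(2) n1 s1 MP a2P n2 s2 in simp)
  then obtain Mb N2 where Mb: "lim_over M0 Mb" "a2 \<in> s_univ Mb" "le P' N2" "le Mb N2"
    "\<not> splits K le N Mb (gtp K le Mb a1 N2)" by blast
  have MbK: "Mb \<in> Kc K" by (rule limit_over_Kc(2)[OF Mb(1)])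
  have M0Mb: "le M0 Mb" using univ_overD(3)[OF limit_over_imp_univ[OF Mb(1)]] .
  \<comment> \<open>\<open>N2\<close> may be uncountable, while nonforking takes place in countable
    models.\<close>
  obtain N3 where N3: "N3 \<in> Kc K" "le N3 N2" "s_univ P' \<subseteq> s_univ N3" "s_univ Mb \<subseteq> s_univ N3"
    using Kc_between[OF le_in(2)[OF Mb(3)] le_univ[OF Mb(3)] Kc_countable[OF P'(1)] MbK le_univ[OF Mb(4)]] .
  have PN3: "le P' N3" by (rule coherence[OF Mb(3) N3(2,3)])
  have MbN3: "le Mb N3" by (rule coherence[OF Mb(4) N3(2,4)])
  have a1N3: "a1 \<in> s_univ N3" using a1P N3(3) by blast
  have nb: "nonsplit N Mb a1 N3"
    using splits_iff[OF MbK N3(1) MbN3 a1N3] Mb(5) gtp_le[OF MbN3 N3(2) a1N3] by simp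
  \<comment> \<open>Symmetry of the class yields nonsplitting over \<open>Mb\<close>, but not that
    \<open>a1\<close> lies outside \<open>Mb\<close>. The extension \<open>c\<close> does lie
    outside, and weak uniqueness identifies its type over \<open>Mb\<close> with that of
    \<open>a1\<close>.\<close>
  obtain c Lc where c: "tp_match id (s_univ M0) a1 P' c Lc" "nonsplit N Mb c Lc" "c \<in> s_univ Mb \<Longrightarrow> a1 \<in> s_univ M0"
    using nonsplit_extension[OF limit_over_imp_univ[OF N(1)] M0Mb MbK nP P'(1) M0P a1P] by metis
  have t3: "tp_match id (s_univ M0) a1 P' a1 N3" by (rule tp_match_le[OF P'(1) N3(1) PN3 a1P le_univ[OF M0P]])
  have t4: "tp_match id (s_univ M0) c Lc a1 N3" by (rule tp_match_trans[OF tp_match_sym[OF c(1)] t3]) auto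
  have "tp_match id (s_univ Mb) c Lc a1 N3"
    by (rule nonsplit_unique[OF limit_over_imp_univ[OF N(1)] M0Mb MbK c(2) nb t4])
  then have "a1 \<notin> s_univ Mb" using tp_match_nonalgebraic c(3) a1(2) by blast
  then have "nonfork M0 Mb a1 N3" by (rule nonforkI[OF MbK N3(1) M0Mb MbN3 a1N3 _ N(1) nb])
  then show ?thesis using that[OF Mb(2) M0Mb MbN3 le_trans[OF P'(2) PN3]] by blast
qed

section \<open>The frame axioms\<close>

lemma tp_img_in_gS_na:
  assumes "M \<in> Kc K" "is_iso f M M'" "p \<in> gS_na K le M"
  shows "tp_img K le f M M' p \<in> gS_na K le M'"
proof -
  have p: "p \<in> gS K le M" using assms(3) by (simp add: gS_na_def)
  obtain a N where N: "N \<in> Kc K" "le M N" "a \<in> s_univ N" "p = gtp K le M a N"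
    using gS_Kc[OF p assms(1)] .
  have aM: "a \<notin> s_univ M" using gtp_in_gS_na_iff[OF assms(1) N(1-3)] assms(3) N(4) by simp
  obtain g where g: "inj_on g (s_univ N)" "\<And>x. x \<in> s_univ M \<Longrightarrow> g x = f x" "img g N \<in> Kc K"
    "le (img f M) (img g N)" "emb g N (img g N)"
    using emb_extend[OF emb_iso[OF Kc_in[OF assms(1)] assms(2)] assms(1) N(1,2)] by metis
  have M'f: "M' = img f M" by (rule is_iso_imp_img[OF assms(2)])
  have eq: "tp_img K le f M M' p = gtp K le M' (g a) (img g N)"
    unfolding N(4) by (rule tp_img_gtp[OF assms(1) N(1) g(3) N(2,3) assms(2) g(5,2)])
  have "g ` s_univ M = f ` s_univ M" using g(2) by (rule image_cong[OF refl])
  then have "g a \<notin> s_univ M'"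
    using inj_on_image_mem_iff[OF g(1) N(3) le_univ[OF N(2)]] aM M'f by simp
  then show ?thesis
    using gtp_in_gS_na_iff[OF iso_Kc[OF assms(1,2)] g(3) _ embD(6)[OF g(5) N(3)]] g(4) M'f eq by simp
qed

lemma nonfork_gtp_na: "nonfork M0 M1 a M3 \<Longrightarrow> gtp K le M1 a M3 \<in> gS_na K le M1"
  using gtp_in_gS_na_iff[of M1 M3 a] nonforkD[of M0 M1 a M3] by simp

text \<open>Local character yields some \<open>N i\<close> over which the type does not fork, and
  transitivity lowers the base from \<open>N i\<close> to \<open>N i0\<close>.\<close>

lemma nonfork_continuity:
  assumes r: "wo_limit r" "wo_min r i0" "incr_chain K le r N"
    and "M3 \<in> Kc K" "le (UnionS (N ` Field r)) M3" "a \<in> s_univ M3"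
    and d: "\<And>i. i \<in> Field r \<Longrightarrow> nonfork (N i0) (N i) a M3"
  shows "nonfork (N i0) (UnionS (N ` Field r)) a M3"
proof -
  have "a \<notin> s_univ (UnionS (N ` Field r))" using nonforkD(7)[OF d] by auto
  then obtain i where i: "i \<in> Field r" "nonfork (N i) (UnionS (N ` Field r)) a M3"
    using nonfork_local[OF r(1,3) assms(4-6)] by blast
  show ?thesis by (rule nonfork_trans[OF i(2) d[OF i(1)]])
qed

theorem good_frame: "good_frame_c ar K le (gS_na K le) nonfork"
proof -
  have B: "Kc K \<noteq> {}" "jep_c K le" "nmm_c K le" using superstable by (simp_all add: superstable_c_def)
  have D1: "\<forall>M\<in>Kc K. gS_na K le M \<subseteq> gS_na K le M" by simp
  have D2: "\<forall>M M' f p. M \<in> Kc K \<and> M' \<in> Kc K \<and> is_iso f M M' \<and> p \<in> gS_na K le M \<longrightarrow>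
        tp_img K le f M M' p \<in> gS_na K le M'" using tp_img_in_gS_na by blast
  have D3: "\<forall>M\<in>Kc K. \<forall>N\<in>Kc K. le M N \<and> M \<noteq> N \<longrightarrow>
        (\<exists>a\<in>s_univ N - s_univ M. gtp K le M a N \<in> gS_na K le M)"
  proof (intro ballI impI, elim conjE)
    fix M N assume MN: "M \<in> Kc K" "N \<in> Kc K" "le M N" "M \<noteq> N"
    \<comment> \<open>A submodel with the same universe is the same structure, so a proper extension
      has a new element.\<close>
    have "s_univ M \<noteq> s_univ N"
      using substruc_univ_eq[OF le_substruc[OF MN(3)] _ wf[OF Kc_in[OF MN(2)]]] MN(4) by blast
    then obtain a where a: "a \<in> s_univ N - s_univ M" using le_univ[OF MN(3)] by blast
    then show "\<exists>a\<in>s_univ N - s_univ M. gtp K le M a N \<in> gS_na K le M"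
      using gtp_in_gS_na_iff[OF MN(1-3)] by blast
  qed
  have D4: "\<forall>M\<in>Kc K. countable (gS_na K le M)"
    using stable unfolding stable_c_def gS_na_def by (auto intro: countable_subset[rotated])
  have E1: "\<forall>M0 M1 a M3. nonfork M0 M1 a M3 \<longrightarrow>
        M0 \<in> Kc K \<and> M1 \<in> Kc K \<and> M3 \<in> Kc K \<and> le M0 M1 \<and> le M1 M3 \<and> a \<in> s_univ M3 \<and>
        gtp K le M1 a M3 \<in> gS_na K le M1"
    using nonfork_gtp_na by (simp add: nonforkD)
  have E2: "\<forall>M0 M1 a M3 M3' f. nonfork M0 M1 a M3 \<and> M3' \<in> Kc K \<and> is_iso f M3 M3' \<longrightarrow>
        nonfork (img f M0) (img f M1) (f a) M3'" using nonfork_img by blast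
  have E3: "\<forall>M0 M1 a M3 M0' M1'. nonfork M0 M1 a M3 \<and> M0' \<in> Kc K \<and> M1' \<in> Kc K \<and>
        le M0 M0' \<and> le M0' M1' \<and> le M1' M1 \<longrightarrow> nonfork M0' M1' a M3"
    by (intro allI impI, elim conjE, rule nonfork_mono)
  have E4: "\<forall>M0 M1 a M3 M3'. nonfork M0 M1 a M3 \<and> M3' \<in> Kc K \<and> le M3 M3' \<longrightarrow> nonfork M0 M1 a M3'"
  proof (intro allI impI, elim conjE)
    fix M0 M1 a M3 M3' assume d: "nonfork M0 M1 a M3" and M3': "M3' \<in> Kc K" "le M3 M3'"
    note D = nonforkD[OF d]
    show "nonfork M0 M1 a M3'"
      by (rule nonfork_tp_match[OF d tp_match_le[OF D(3) M3' D(6) le_univ[OF D(5)]] le_trans[OF D(5) M3'(2)]])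
  qed
  have E5: "\<forall>M0 M1 a M3 M3'. nonfork M0 M1 a M3 \<and> M3' \<in> Kc K \<and> le M1 M3' \<and> le M3' M3 \<and>
        a \<in> s_univ M3' \<longrightarrow> nonfork M0 M1 a M3'"
  proof (intro allI impI, elim conjE)
    fix M0 M1 a M3 M3'
    assume d: "nonfork M0 M1 a M3" and M3': "M3' \<in> Kc K" "le M1 M3'" "le M3' M3" "a \<in> s_univ M3'"
    show "nonfork M0 M1 a M3'"
      by (rule nonfork_tp_match[OF d tp_match_sym[OF tp_match_le[OF M3'(1) nonforkD(3)[OF d] M3'(3,4) le_univ[OF M3'(2)]]] M3'(2)])
  qed
  have E6: "\<forall>r N a M3. wo_limit r \<and> incr_chain K le r N \<and> cont_chain r N \<and>
        UnionS (N ` Field r) \<in> Kc K \<and> M3 \<in> Kc K \<and> le (UnionS (N ` Field r)) M3 \<and>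
        a \<in> s_univ M3 \<and> gtp K le (UnionS (N ` Field r)) a M3 \<in> gS_na K le (UnionS (N ` Field r)) \<longrightarrow>
        (\<exists>i\<in>Field r. nonfork (N i) (UnionS (N ` Field r)) a M3)"
  proof (intro allI impI, elim conjE)
    fix r N a M3
    assume r: "wo_limit r" "incr_chain K le r N" and U: "UnionS (N ` Field r) \<in> Kc K"
      and M3: "M3 \<in> Kc K" "le (UnionS (N ` Field r)) M3" "a \<in> s_univ M3"
      and na: "gtp K le (UnionS (N ` Field r)) a M3 \<in> gS_na K le (UnionS (N ` Field r))"
    have "a \<notin> s_univ (UnionS (N ` Field r))" using gtp_in_gS_na_iff[OF U M3] na by blast
    from nonfork_local[OF r M3 this] show "\<exists>i\<in>Field r. nonfork (N i) (UnionS (N ` Field r)) a M3" by blast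
  qed
  have E7: "\<forall>M0 M1 M2 a M3. le M0 M1 \<and> le M1 M2 \<and> nonfork M1 M2 a M3 \<and> nonfork M0 M1 a M3 \<longrightarrow>
        nonfork M0 M2 a M3" using nonfork_trans by blast
  have E8: "\<forall>M0 M1 a N b N'. nonfork M0 M1 a N \<and> nonfork M0 M1 b N' \<and> gtp K le M0 a N = gtp K le M0 b N' \<longrightarrow>
        gtp K le M1 a N = gtp K le M1 b N'"
  proof (intro allI impI, elim conjE)
    fix M0 M1 a N b N'
    assume a: "nonfork M0 M1 a N" and b: "nonfork M0 M1 b N'" and eq: "gtp K le M0 a N = gtp K le M0 b N'"
    note A = nonforkD[OF a] and B = nonforkD[OF b]
    have "tp_match id (s_univ M0) a N b N'"
      using gtp_eq_iff_tp_match[OF A(1,3) B(3) le_trans[OF A(4,5)] le_trans[OF A(4) B(5)] A(6) B(6)] eq by simp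
    from nonfork_unique[OF a b this] show "gtp K le M1 a N = gtp K le M1 b N'"
      using gtp_eq_iff_tp_match[OF A(2,3) B(3) A(5) B(5) A(6) B(6)] by simp
  qed
  have E9: "\<forall>M0 M1 M3 a1 a2. M0 \<in> Kc K \<and> M1 \<in> Kc K \<and> M3 \<in> Kc K \<and> le M0 M1 \<and> le M1 M3 \<and>
        a1 \<in> s_univ M1 \<and> a2 \<in> s_univ M3 \<and> gtp K le M0 a1 M3 \<in> gS_na K le M0 \<and> nonfork M0 M1 a2 M3 \<longrightarrow>
        (\<exists>M2 M3'. M2 \<in> Kc K \<and> M3' \<in> Kc K \<and> a2 \<in> s_univ M2 \<and> le M0 M2 \<and> le M2 M3' \<and>
           le M3 M3' \<and> nonfork M0 M2 a1 M3')"
  proof (intro allI impI, elim conjE)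
    fix M0 M1 M3 a1 a2
    assume M: "M0 \<in> Kc K" "M1 \<in> Kc K" "M3 \<in> Kc K" "le M0 M1" "le M1 M3"
      and a1: "a1 \<in> s_univ M1" "gtp K le M0 a1 M3 \<in> gS_na K le M0" and d: "nonfork M0 M1 a2 M3"
    have "a1 \<in> s_univ M3" using a1(1) le_univ[OF M(5)] by blast
    then have "a1 \<notin> s_univ M0" using gtp_in_gS_na_iff[OF M(1,3) le_trans[OF M(4,5)]] a1(2) by blast
    from nonfork_symmetry[OF M a1(1) this d] obtain M2 M3' where
      "a2 \<in> s_univ M2" "le M0 M2" "le M2 M3'" "le M3 M3'" "nonfork M0 M2 a1 M3'" .
    then show "\<exists>M2 M3'. M2 \<in> Kc K \<and> M3' \<in> Kc K \<and> a2 \<in> s_univ M2 \<and> le M0 M2 \<and> le M2 M3' \<and>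
           le M3 M3' \<and> nonfork M0 M2 a1 M3'" using nonforkD(2,3) by blast
  qed
  have E10: "\<forall>M N p. M \<in> Kc K \<and> N \<in> Kc K \<and> le M N \<and> p \<in> gS_na K le M \<longrightarrow>
        (\<exists>b N'. nonfork M N b N' \<and> restr K le M (gtp K le N b N') = p)"
  proof (intro allI impI, elim conjE)
    fix M N p assume M: "M \<in> Kc K" "N \<in> Kc K" "le M N" and p: "p \<in> gS_na K le M"
    have pS: "p \<in> gS K le M" using p by (simp add: gS_na_def)
    obtain a L where L: "L \<in> Kc K" "le M L" "a \<in> s_univ L" "p = gtp K le M a L" using gS_Kc[OF pS M(1)] .
    have "a \<notin> s_univ M" using gtp_in_gS_na_iff[OF M(1) L(1-3)] p L(4) by simp
    then obtain b L' where b: "nonfork M N b L'" "tp_match id (s_univ M) a L b L'"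
      using nonfork_extension[OF M L(1-3)] by blast
    note D = nonforkD[OF b(1)]
    have "gtp K le M b L' = p"
      using gtp_eq_iff_tp_match[OF M(1) L(1) D(3) L(2) le_trans[OF M(3) D(5)] L(3) D(6)] b(2) L(4) by simp
    then have "restr K le M (gtp K le N b L') = p" using restr_gtp[OF M(3) D(5,6)] by simp
    then show "\<exists>b N'. nonfork M N b N' \<and> restr K le M (gtp K le N b N') = p" using b(1) by blast
  qed
  have E11: "\<forall>r N i0 a M3. wo_limit r \<and> wo_min r i0 \<and> incr_chain K le r N \<and> cont_chain r N \<and>
        UnionS (N ` Field r) \<in> Kc K \<and> M3 \<in> Kc K \<and> le (UnionS (N ` Field r)) M3 \<and>
        a \<in> s_univ M3 \<and> (\<forall>i\<in>Field r. nonfork (N i0) (N i) a M3) \<longrightarrow>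
        nonfork (N i0) (UnionS (N ` Field r)) a M3"
    by (intro allI impI, elim conjE) (rule nonfork_continuity, auto)
  show ?thesis unfolding good_frame_c_def
    by (intro conjI; fact aec ls ap stable B D1 D2 D3 D4 E1 E2 E3 E4 E5 E6 E7 E8 E9 E10 E11)
qed

end

theorem theorem8p8:
  fixes ar :: "'r \<Rightarrow> nat"
    and K :: "('a,'r) struc set"
    and le :: "('a,'r) struc \<Rightarrow> ('a,'r) struc \<Rightarrow> bool"
  assumes "\<not> countable (UNIV :: 'a set)"
    and "aec ar K le"
    and "ls_le_aleph0 ar K le"
    and "superstable_c K le"
    and "symmetry_c K le"
    and "transitivity_c K le"
    and "categorical_c K le"
    and "saturative_c K le"
  shows "\<exists>Sbs nf. good_frame_c ar K le Sbs nf \<and> type_full_c K le Sbs"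
proof -
  have "ap_c K le" using assms(4) by (simp add: superstable_c_def)
  then interpret superstable_aec ar K le using assms by unfold_locales
  show ?thesis using good_frame by (auto simp: type_full_c_def)
qed

end
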